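(* Let $a,b\in\mathbb{R}$ with $a<b$. Let $X=(X(t))_{t\in[a,b]}$ be a real-valued second order process which is almost surely and mean square continuously differentiable on $[a,b]$. Then the function $\alpha\mapsto C_X(\alpha,[a,b])$ belongs to $L^1(\mathbb{R})$ and its Fourier transform $u\mapsto\widehat{C_X}(u,[a,b])$ is given, for all $u\in\mathbb{R}$, by $$\widehat{C_X}(u,[a,b])=\int_a^b\mathbb{E}\bigl(e^{iuX(t)}|X'(t)|\bigr)\,dt.$$ Moreover, if $\psi_t(u,v)=\mathbb{E}\bigl(e^{iuX(t)+ivX'(t)}\bigr)$ denotes the joint characteristic function of $(X(t),X'(t))$, then for all $u\in\mathbb{R}$ $$\widehat{C_X}(u,[a,b])=-\frac1\pi\int_a^b\int_0^{+\infty}\frac1v\left(\frac{\partial\psi_t}{\partial v}(u,v)-\frac{\partial\psi_t}{\partial v}(u,-v)\right)dv\,dt$$ $$=-\frac1\pi\int_a^b\int_0^{+\infty}\frac1{v^2}\bigl(\psi_t(u,v)+\psi_t(u,-v)-2\psi_t(u,0)\bigr)\,dv\,dt,$$ where the inner integrals over $(0,+\infty)$ are understood as $\lim_{A\to+\infty}\int_0^A$.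
   Context: $N_X(\alpha,[a,b])=\#\{t\in[a,b]: X(t)=\alpha\}$ is the number of crossings of the level $\alpha\in\mathbb{R}$, and $C_X(\alpha,[a,b])=\mathbb{E}(N_X(\alpha,[a,b]))\in[0,+\infty]$ is the mean number of crossings. The Fourier transform convention is $\widehat{C_X}(u,[a,b])=\int_{\mathbb{R}}e^{iu\alpha}C_X(\alpha,[a,b])\,d\alpha$. A second order process is one with $\mathbb{E}(X(t)^2)<\infty$ for all $t$. Almost surely continuously differentiable means that almost surely the sample paths are $C^1$; mean square continuously differentiable means that $X$ is differentiable as a map into $L^2(\Omega)$ with continuous derivative; the two derivatives agree and are denoted $X'$. *)

theory Defs
  imports "HOL-Probability.Probability"
begin

text \<open>
  A process indexed by \<open>{a..b}\<close> is a function \<open>X :: real \<Rightarrow> 'w \<Rightarrow> real\<close>; its values at times outside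
  \<open>{a..b}\<close> are never used. In particular all derivatives are taken within \<open>{a..b}\<close>, so they are
  one-sided at the endpoints.
\<close>

definition square_integrable :: "'w measure \<Rightarrow> ('w \<Rightarrow> real) \<Rightarrow> bool" where
  "square_integrable M f \<longleftrightarrow> f \<in> borel_measurable M \<and> integrable M (\<lambda>w. (f w)\<^sup>2)"

definition second_order_process ::
  "'w measure \<Rightarrow> real \<Rightarrow> real \<Rightarrow> (real \<Rightarrow> 'w \<Rightarrow> real) \<Rightarrow> bool" where
  "second_order_process M a b X \<longleftrightarrow> (\<forall>t\<in>{a..b}. square_integrable M (X t))"

definition almost_surely_C1 ::
  "'w measure \<Rightarrow> real \<Rightarrow> real \<Rightarrow> (real \<Rightarrow> 'w \<Rightarrow> real) \<Rightarrow> bool" where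
  "almost_surely_C1 M a b X \<longleftrightarrow>
     (AE w in M. \<exists>D. (\<forall>t\<in>{a..b}. ((\<lambda>s. X s w) has_real_derivative D t) (at t within {a..b})) \<and>
                     continuous_on {a..b} D)"

text \<open>
  Square integrability of all functions involved makes every integral below that of an
  integrable function, namely a squared distance in \<open>L\<^sup>2\<close>.
\<close>

definition mean_square_C1 ::
  "'w measure \<Rightarrow> real \<Rightarrow> real \<Rightarrow> (real \<Rightarrow> 'w \<Rightarrow> real) \<Rightarrow> bool" where
  "mean_square_C1 M a b X \<longleftrightarrow> second_order_process M a b X \<and>
     (\<exists>D. (\<forall>t\<in>{a..b}. square_integrable M (D t)) \<and>
          (\<forall>t\<in>{a..b}. ((\<lambda>s. \<integral>w. ((X s w - X t w) / (s - t) - D t w)\<^sup>2 \<partial>M) \<longlongrightarrow> 0)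
                          (at t within {a..b})) \<and>
          (\<forall>t\<in>{a..b}. ((\<lambda>s. \<integral>w. (D s w - D t w)\<^sup>2 \<partial>M) \<longlongrightarrow> 0) (at t within {a..b})))"

text \<open>
  The measure space need not be complete, so the pathwise derivative at \<open>t\<close> is in general only
  almost everywhere equal to a random variable. The process \<open>X'\<close> below is any such version. For a
  process that is also mean square differentiable, \<open>X' t\<close> agrees almost surely with
  the mean square derivative at \<open>t\<close>, by uniqueness of limits in probability.
\<close>

definition derivative_process ::
  "'w measure \<Rightarrow> real \<Rightarrow> real \<Rightarrow> (real \<Rightarrow> 'w \<Rightarrow> real) \<Rightarrow> (real \<Rightarrow> 'w \<Rightarrow> real) \<Rightarrow> bool" where
  "derivative_process M a b X X' \<longleftrightarrow>
     (\<forall>t\<in>{a..b}. X' t \<in> borel_measurable M \<and>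
        (AE w in M. ((\<lambda>s. X s w) has_real_derivative X' t w) (at t within {a..b})))"

text \<open>The counting measure gives \<open>\<infinity>\<close>, rather than \<open>0\<close>, when the level set is infinite.\<close>

definition crossings ::
  "(real \<Rightarrow> 'w \<Rightarrow> real) \<Rightarrow> real \<Rightarrow> real \<Rightarrow> real \<Rightarrow> 'w \<Rightarrow> ennreal" where
  "crossings X a b \<alpha> w = emeasure (count_space UNIV) {t \<in> {a..b}. X t w = \<alpha>}"

definition mean_crossings ::
  "'w measure \<Rightarrow> (real \<Rightarrow> 'w \<Rightarrow> real) \<Rightarrow> real \<Rightarrow> real \<Rightarrow> real \<Rightarrow> ennreal" where
  "mean_crossings M X a b \<alpha> = (\<integral>\<^sup>+w. crossings X a b \<alpha> w \<partial>M)"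

definition fourier_transform :: "(real \<Rightarrow> complex) \<Rightarrow> real \<Rightarrow> complex" where
  "fourier_transform g u = (\<integral>\<alpha>. exp (\<i> * of_real (u * \<alpha>)) * g \<alpha> \<partial>lborel)"

text \<open>
  Once \<open>mean_crossings\<close> has finite integral it is finite almost everywhere, so \<open>enn2real\<close>
  changes it only on a null set of levels.
\<close>

definition fourier_mean_crossings ::
  "'w measure \<Rightarrow> (real \<Rightarrow> 'w \<Rightarrow> real) \<Rightarrow> real \<Rightarrow> real \<Rightarrow> real \<Rightarrow> complex" where
  "fourier_mean_crossings M X a b =
     fourier_transform (\<lambda>\<alpha>. of_real (enn2real (mean_crossings M X a b \<alpha>)))"

definition joint_char ::
  "'w measure \<Rightarrow> ('w \<Rightarrow> real) \<Rightarrow> ('w \<Rightarrow> real) \<Rightarrow> real \<Rightarrow> real \<Rightarrow> complex" where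
  "joint_char M Y Z u v = (\<integral>w. exp (\<i> * of_real (u * Y w) + \<i> * of_real (v * Z w)) \<partial>M)"

definition joint_char_dv ::
  "'w measure \<Rightarrow> ('w \<Rightarrow> real) \<Rightarrow> ('w \<Rightarrow> real) \<Rightarrow> real \<Rightarrow> real \<Rightarrow> complex" where
  "joint_char_dv M Y Z u v = vector_derivative (joint_char M Y Z u) (at v)"

text \<open>
  Integrals over \<open>(0,\<infinity>)\<close> as limits of integrals over \<open>(0,A]\<close>; this is weaker than Lebesgue
  integrability on \<open>(0,\<infinity>)\<close>.
\<close>

definition improper_integral :: "(real \<Rightarrow> complex) \<Rightarrow> complex" where
  "improper_integral f = Lim at_top (\<lambda>A::real. LINT v:{0<..A}|lborel. f v)"

definition improper_integrable :: "(real \<Rightarrow> complex) \<Rightarrow> bool" where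
  "improper_integrable f \<longleftrightarrow>
     (\<forall>A. set_integrable lborel {0<..A} f) \<and>
     (\<exists>l. ((\<lambda>A::real. LINT v:{0<..A}|lborel. f v) \<longlongrightarrow> l) at_top)"

end

theory Submission
  imports Defs
begin

text \<open>
  For a $C^1$ path $g$ the Banach indicatrix formula
  $\int f(y)\, \#\{t : g(t) = y\}\, dy = \int_a^b f(g(t)) |g'(t)|\, dt$ holds. It is obtained by
  counting, for a uniform partition of $[a,b]$, the cells on which the level $y$ is attained; these
  counts are dominated by, and converge to, the number of crossings. Applied to
  $f(y) = e^{iuy}$ on almost every path, with Fubini on both sides, it gives the first formula for
  the Fourier transform. The other two follow for each fixed $t$ from
  $\int_0^\infty \frac{\sin(vz)}{v}\, z\, dv = \frac{\pi}{2}|z|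
    = \int_0^\infty \frac{1 - \cos(vz)}{v^2}\, dv$, whose truncations to $(0,A]$ are bounded by a
  multiple of $|z|$, so that dominated convergence applies to $z = X'(t)$.
\<close>

section \<open>The Banach indicatrix of a continuously differentiable path\<close>

text \<open>Uniform partitions into \<open>n\<close> and \<open>n + 1\<close> cells do not refine
  each other, so the counts need not increase with \<open>n\<close>: Fatou gives one inequality for
  their limit, domination by the number of crossings the other. The counts serve a second purpose.
  They show that the number of crossings is jointly measurable in level and outcome, which the
  exchanges of integrals presuppose. Fubini also needs \<open>\<bar>X'\<bar>\<close> to be
  integrable over [a,b] times the probability space; mean square continuity of the derivative
  provides this, as it bounds the second moment uniformly on the compact interval. Paths are regular
  only almost surely, and \<open>X'\<close> is only a version of the derivative at each time, so the
  argument is run for a modification \<open>Y\<close> all of whose paths are continuously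
  differentiable, with derivative \<open>Z\<close>, and carried back at the end. The constant
  \<open>pi\<close> has a single source, the limit of \<open>Si\<close> at infinity; the two
  characteristic function formulas share it because their kernels are related by integration by
  parts, with a boundary term that vanishes at infinity.\<close>

definition cell :: "real \<Rightarrow> real \<Rightarrow> nat \<Rightarrow> real \<Rightarrow> int" where
  "cell a b n t = \<lfloor>(t - a) * real n / (b - a)\<rfloor>"

text \<open>Since \<open>cell\<close> maps times to indices, the number of occupied cells is the
  cardinality of an image. It is therefore at most the number of crossings, with equality once
  \<open>cell\<close> is injective on a finite level set.\<close>

definition level_cells :: "(real \<Rightarrow> real) \<Rightarrow> real \<Rightarrow> real \<Rightarrow> nat \<Rightarrow> real \<Rightarrow> nat" where
  "level_cells g a b n y = card (cell a b n ` {t \<in> {a..b}. g t = y})"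

text \<open>The endpoint \<open>b\<close> gets index \<open>n\<close>, hence a cell of its own.\<close>

lemma cell_range:
  assumes "a < b" "t \<in> {a..b}"
  shows "cell a b n t \<in> int ` {..n}"
proof -
  have "0 \<le> (t - a) * real n / (b - a)" using assms by simp
  moreover have "(t - a) * real n / (b - a) \<le> real n"
    using assms by (simp add: divide_le_eq mult.commute mult_left_mono)
  ultimately have "0 \<le> cell a b n t" "cell a b n t \<le> int n"
    unfolding cell_def by linarith+
  then show ?thesis by (intro image_eqI[of _ _ "nat (cell a b n t)"]) auto
qed

lemma level_cells_le:
  assumes "a < b"
  shows "of_nat (level_cells g a b n y) \<le> emeasure (count_space UNIV) {t \<in> {a..b}. g t = y}"
proof (cases "finite {t \<in> {a..b}. g t = y}")
  case True
  then show ?thesis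
    unfolding level_cells_def by (simp add: card_image_le)
next
  case False
  then show ?thesis by (subst emeasure_count_space_infinite) auto
qed

text \<open>Two times fall into different cells as soon as the mesh is at most their distance,
  because the arguments of the floor then differ by at least 1. A finite set has only finitely many
  pairs.\<close>

lemma eventually_inj_on_cell:
  assumes "a < b" "finite S"
  shows "\<forall>\<^sub>F n in sequentially. inj_on (cell a b n) S"
proof -
  have *: "\<forall>\<^sub>F n in sequentially. cell a b n s \<noteq> cell a b n t" if "s < t" for s t
  proof -
    have "\<forall>\<^sub>F n in sequentially. (b - a) / (t - s) \<le> real n"
      using filterlim_real_sequentially by (simp add: filterlim_at_top)
    then show ?thesis
    proof eventually_elim
      case (elim n)
      have "1 \<le> (t - s) * real n / (b - a)"
        using elim that assms by (simp add: field_simps)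
      then have "(s - a) * real n / (b - a) + 1 \<le> (t - a) * real n / (b - a)"
        by (simp add: diff_divide_distrib left_diff_distrib)
      then show ?case unfolding cell_def by linarith
    qed
  qed
  have "\<forall>\<^sub>F n in sequentially. cell a b n s \<noteq> cell a b n t" if "s \<noteq> t" for s t
    using *[of s t] *[of t s] that by (cases "s < t") (auto simp: eq_commute)
  then have "\<forall>\<^sub>F n in sequentially. \<forall>s\<in>S. \<forall>t\<in>S. s \<noteq> t \<longrightarrow> cell a b n s \<noteq> cell a b n t"
    using assms(2) by (intro eventually_ball_finite ballI) auto
  then show ?thesis by eventually_elim (auto simp: inj_on_def)
qed

lemma level_cells_tendsto:
  assumes "a < b"
  shows "(\<lambda>n. of_nat (level_cells g a b n y)) \<longlonglongrightarrow>
    emeasure (count_space UNIV) {t \<in> {a..b}. g t = y}"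
proof (rule order_tendstoI)
  let ?L = "{t \<in> {a..b}. g t = y}"
  fix l assume l: "l < emeasure (count_space UNIV) ?L"
  \<comment> \<open>The level set may be infinite, so its size is tested through finite subsets; one
    with more than \<open>l\<close> points exists in either case.\<close>
  obtain S where S: "finite S" "S \<subseteq> ?L" "l < of_nat (card S)"
  proof (cases "finite ?L")
    case True
    then show ?thesis using l that[of ?L] by simp
  next
    case False
    then have "l < top" using l by auto
    then obtain k :: nat where "l < of_nat k" 
      using ennreal_Ex_less_of_nat by blast
    moreover obtain S where "S \<subseteq> ?L" "finite S" "card S = k"
      using infinite_arbitrarily_large[OF False] by blast
    ultimately show ?thesis using that by blast
  qed
  show "\<forall>\<^sub>F n in sequentially. l < of_nat (level_cells g a b n y)"
    using eventually_inj_on_cell[OF assms S(1)]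
  proof eventually_elim
    case (elim n)
    have "finite (cell a b n ` ?L)"
      by (rule finite_subset[of _ "int ` {..n}"]) (use cell_range[OF assms] in auto)
    then have "card S \<le> level_cells g a b n y"
      unfolding level_cells_def card_image[OF elim, symmetric] using S(2) by (intro card_mono) auto
    then show ?case using S(3) by (meson less_le_trans of_nat_mono)
  qed
next
  fix u assume "emeasure (count_space UNIV) {t \<in> {a..b}. g t = y} < u"
  then show "\<forall>\<^sub>F n in sequentially. of_nat (level_cells g a b n y) < u"
    using level_cells_le[OF assms] by (intro always_eventually allI) (rule le_less_trans)
qed

text \<open>Trades counting times at a fixed level for a function of the level: a finite sum of
  indicators of images, whose measurability and integral can be treated cell by cell.\<close>

lemma level_cells_eq_sum:
  assumes "a < b"
  shows "real (level_cells g a b n y) =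
    (\<Sum>j\<le>n. indicator (g ` {t \<in> {a..b}. cell a b n t = int j}) y)"
proof -
  have "cell a b n ` {t \<in> {a..b}. g t = y} =
      int ` {j \<in> {..n}. y \<in> g ` {t \<in> {a..b}. cell a b n t = int j}}" (is "?l = int ` ?r")
  proof (intro equalityI subsetI)
    fix i assume "i \<in> ?l"
    then obtain t where t: "t \<in> {a..b}" "g t = y" "i = cell a b n t" by blast
    moreover obtain j where "i = int j" "j \<le> n" using cell_range[OF assms t(1), of n] t(3) by auto
    ultimately show "i \<in> int ` ?r" by blast
  next
    fix i assume "i \<in> int ` ?r"
    then obtain t where "t \<in> {a..b}" "y = g t" "cell a b n t = i" by auto
    then show "i \<in> ?l" by blast
  qed
  then have "level_cells g a b n y = card ?r"
    unfolding level_cells_def by (simp add: card_image)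
  also have "real \<dots> = (\<Sum>j\<le>n. indicator (g ` {t \<in> {a..b}. cell a b n t = int j}) y)"
    by (simp add: indicator_def sum.If_cases Int_def)
  finally show ?thesis .
qed

lemma cell_eq_iff:
  assumes "a < b" "0 < n"
  shows "cell a b n t = int j \<longleftrightarrow>
    a + real j * ((b - a) / real n) \<le> t \<and> t < a + real (Suc j) * ((b - a) / real n)"
proof -
  define h where "h = (b - a) / real n"
  have h: "0 < h" using assms by (simp add: h_def)
  have "(t - a) * real n / (b - a) = (t - a) / h" by (simp add: h_def)
  then have "cell a b n t = int j \<longleftrightarrow> real j \<le> (t - a) / h \<and> (t - a) / h < real j + 1"
    unfolding cell_def floor_eq_iff by simp
  also have "\<dots> \<longleftrightarrow> real j * h \<le> t - a \<and> t - a < (real j + 1) * h"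
    using h by (simp only: pos_le_divide_eq pos_divide_less_eq)
  also have "\<dots> \<longleftrightarrow> a + real j * h \<le> t \<and> t < a + real (Suc j) * h"
    by (simp add: algebra_simps)
  finally show ?thesis unfolding h_def .
qed

lemma cell_eq_interval:
  assumes "a < b" "j < n"
  shows "{t \<in> {a..b}. cell a b n t = int j} =
    {a + real j * ((b - a) / real n)..<a + real (Suc j) * ((b - a) / real n)}" (is "_ = {?p..<?q}")
proof -
  have "real (Suc j) * ((b - a) / real n) \<le> real n * ((b - a) / real n)"
    using assms by (intro mult_right_mono) auto
  then have q: "?q \<le> b" using assms by simp
  have p: "a \<le> ?p" using assms by simp
  have "a \<le> t \<and> t \<le> b" if "?p \<le> t" "t < ?q" for t
    using order_trans[OF p that(1)] less_le_trans[OF that(2) q] by (intro conjI) (assumption | rule less_imp_le)+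
  then show ?thesis
    unfolding set_eq_iff mem_Collect_eq atLeastLessThan_iff atLeastAtMost_iff
      cell_eq_iff[OF assms(1) le_less_trans[OF le0 assms(2)]] by blast
qed

lemma cell_eq_last:
  assumes "a < b" "0 < n"
  shows "{t \<in> {a..b}. cell a b n t = int n} = {b}"
proof -
  have "a + real n * ((b - a) / real n) = b" "b < a + real (Suc n) * ((b - a) / real n)"
    using assms by (simp_all add: add_divide_distrib distrib_right)
  then show ?thesis
    unfolding cell_eq_iff[OF assms] using assms(1) by (intro set_eqI) (simp, linarith)
qed

section \<open>Change of variables on a single cell\<close>

lemma image_interval_real_derivative_nonneg:
  fixes g g' :: "real \<Rightarrow> real"
  assumes "p \<le> q"
    and der: "\<And>t. t \<in> {p..q} \<Longrightarrow> (g has_real_derivative g' t) (at t within {p..q})"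
    and nonneg: "\<And>t. t \<in> {p..q} \<Longrightarrow> 0 \<le> g' t"
  shows "g ` {p..q} = {g p..g q}"
proof -
  have mono: "g s \<le> g t" if "p \<le> s" "s \<le> t" "t \<le> q" for s t
  proof -
    have "(g has_derivative (*) (g' x)) (at x within {s..t})" if "s \<le> x" "x \<le> t" for x
      using DERIV_subset[OF der[of x], of "{s..t}"] that \<open>p \<le> s\<close> \<open>t \<le> q\<close>
      by (auto simp: has_field_derivative_def)
    from mvt_very_simple[OF that(2) this] obtain x where "x \<in> {s..t}" "g t - g s = g' x * (t - s)"
      by blast
    moreover have "0 \<le> g' x * (t - s)" using nonneg[of x] calculation(1) that by auto
    ultimately show ?thesis by simp
  qed
  have cont: "continuous_on {p..q} g"
    using der by (meson DERIV_continuous continuous_on_eq_continuous_within)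
  have "y \<in> g ` {p..q}" if "y \<in> {g p..g q}" for y
    using IVT'[of g p y q] that \<open>p \<le> q\<close> cont by auto
  then show ?thesis using mono by auto
qed

lemma image_interval_real_derivative_nonpos:
  fixes g g' :: "real \<Rightarrow> real"
  assumes "p \<le> q"
    and der: "\<And>t. t \<in> {p..q} \<Longrightarrow> (g has_real_derivative g' t) (at t within {p..q})"
    and nonpos: "\<And>t. t \<in> {p..q} \<Longrightarrow> g' t \<le> 0"
  shows "g ` {p..q} = {g q..g p}"
proof -
  have "(\<lambda>t. - g t) ` {p..q} = {- g p..- g q}"
    using nonpos by (intro image_interval_real_derivative_nonneg[OF \<open>p \<le> q\<close> DERIV_minus[OF der]]) auto
  then have "uminus ` (\<lambda>t. - g t) ` {p..q} = uminus ` {- g p..- g q}" by simp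
  then show ?thesis by (simp add: image_image)
qed

text \<open>Substitution is oriented. On a decreasing piece the sign from reversing the end values
  \<open>g p\<close> and \<open>g q\<close> turns \<open>g'\<close> into
  \<open>\<bar>g'\<bar>\<close>. Flat stretches do no harm, since the image is still the full
  interval between the end values.\<close>

lemma integral_image_fixed_sign:
  fixes g g' :: "real \<Rightarrow> real" and f :: "real \<Rightarrow> complex"
  assumes "p \<le> q"
    and der: "\<And>t. t \<in> {p..q} \<Longrightarrow> (g has_real_derivative g' t) (at t within {p..q})"
    and cont: "continuous_on {p..q} g'" "continuous_on UNIV f"
    and sgn: "(\<forall>t\<in>{p..q}. 0 \<le> g' t) \<or> (\<forall>t\<in>{p..q}. g' t \<le> 0)"
  shows "(LINT y:g ` {p..q}|lborel. f y) = (LINT t:{p..q}|lborel. of_real \<bar>g' t\<bar> * f (g t))"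
proof -
  have eq: "(LBINT t=p..q. g' t *\<^sub>R f (g t)) = (LBINT y=g p..g q. f y)"
    using der cont by (intro interval_integral_substitution_finite[OF \<open>p \<le> q\<close>])
      (auto intro: continuous_on_subset)
  from sgn show ?thesis
  proof
    assume *: "\<forall>t\<in>{p..q}. 0 \<le> g' t"
    have im: "g ` {p..q} = {g p..g q}"
      using * by (intro image_interval_real_derivative_nonneg[OF \<open>p \<le> q\<close> der]) auto
    have "g p \<le> g q" using im \<open>p \<le> q\<close> by (metis atLeastatMost_empty_iff2 image_is_empty)
    then have "(LINT y:g ` {p..q}|lborel. f y) = (LINT t:{p..q}|lborel. g' t *\<^sub>R f (g t))"
      unfolding im using eq \<open>p \<le> q\<close> by (simp add: interval_integral_Icc)
    also have "\<dots> = (LINT t:{p..q}|lborel. of_real \<bar>g' t\<bar> * f (g t))"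
      using * by (intro set_lebesgue_integral_cong) (auto simp: scaleR_conv_of_real)
    finally show ?thesis .
  next
    assume *: "\<forall>t\<in>{p..q}. g' t \<le> 0"
    have im: "g ` {p..q} = {g q..g p}"
      using * by (intro image_interval_real_derivative_nonpos[OF \<open>p \<le> q\<close> der]) auto
    have "g q \<le> g p" using im \<open>p \<le> q\<close> by (metis atLeastatMost_empty_iff2 image_is_empty)
    then have "(LINT y:g ` {p..q}|lborel. f y) = - (LINT t:{p..q}|lborel. g' t *\<^sub>R f (g t))"
      unfolding im using eq \<open>p \<le> q\<close>
      by (simp add: interval_integral_Icc interval_integral_endpoints_reverse[of "g p" "g q"])
    also have "\<dots> = (LINT t:{p..q}|lborel. - (g' t *\<^sub>R f (g t)))"
      by (simp add: set_lebesgue_integral_def)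
    also have "\<dots> = (LINT t:{p..q}|lborel. of_real \<bar>g' t\<bar> * f (g t))"
      using * by (intro set_lebesgue_integral_cong) (auto simp: scaleR_conv_of_real)
    finally show ?thesis .
  qed
qed

lemma image_interval_lipschitz:
  fixes g g' :: "real \<Rightarrow> real"
  assumes "p \<le> q"
    and der: "\<And>t. t \<in> {p..q} \<Longrightarrow> (g has_real_derivative g' t) (at t within {p..q})"
    and le: "\<And>t. t \<in> {p..q} \<Longrightarrow> \<bar>g' t\<bar> \<le> e"
  obtains c d where "g ` {p..q} = {c..d}" "c \<le> d" "d - c \<le> e * (q - p)"
proof -
  have cont: "continuous_on {p..q} g"
    using der by (meson DERIV_continuous continuous_on_eq_continuous_within)
  obtain c d where im: "g ` {p..q} = {c..d}" "c \<le> d"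
    using continuous_image_closed_interval[OF \<open>p \<le> q\<close> cont] by blast
  then obtain s t where "s \<in> {p..q}" "t \<in> {p..q}" "g s = c" "g t = d"
    by (metis atLeastAtMost_iff imageE order_refl)
  moreover have "norm (g t - g s) \<le> e * norm (t - s)"
    using calculation(1,2) le by (intro field_differentiable_bound[OF _ der]) auto
  moreover have "e * \<bar>t - s\<bar> \<le> e * (q - p)"
    using calculation(1,2) le[of s] by (intro mult_left_mono) auto
  ultimately have "d - c \<le> e * (q - p)" by auto
  then show thesis using im that by blast
qed

lemma norm_integral_interval_le:
  fixes f :: "real \<Rightarrow> complex"
  assumes "p \<le> q" "0 \<le> B" "\<And>t. t \<in> {p..q} \<Longrightarrow> norm (f t) \<le> B"
  shows "norm (LINT t:{p..q}|lborel. f t) \<le> B * (q - p)"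
proof (cases "set_integrable lborel {p..q} f")
  case True
  have "norm (LINT t:{p..q}|lborel. f t) \<le> (LINT t:{p..q}|lborel. norm (f t))"
    using set_integral_norm_bound[OF True] .
  also have "\<dots> \<le> (LINT t:{p..q}|lborel. B)"
    using assms(3)
    by (intro set_integral_mono set_integrable_norm True borel_integrable_atLeastAtMost'
        continuous_on_const) auto
  also have "\<dots> = B * (q - p)" using assms(1) by (simp add: set_lebesgue_integral_def)
  finally show ?thesis .
next
  \<comment> \<open>The integral of a non-integrable function is 0 by convention, and the right-hand
    side is nonnegative.\<close>
  case False
  then show ?thesis using assms
    by (simp add: set_integrable_def set_lebesgue_integral_def not_integrable_integral_eq)
qed

text \<open>
  If \<open>g'\<close> has constant sign, substitution is exact. Otherwise \<open>g'\<close> vanishes somewhere in \<open>{p..q}\<close>,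
  so \<open>\<bar>g'\<bar> \<le> e\<close> there and both integrals are small.
\<close>

lemma integral_image_approx:
  fixes g g' :: "real \<Rightarrow> real" and f :: "real \<Rightarrow> complex"
  assumes "p \<le> q"
    and der: "\<And>t. t \<in> {p..q} \<Longrightarrow> (g has_real_derivative g' t) (at t within {p..q})"
    and cont: "continuous_on {p..q} g'" "continuous_on UNIV f"
    and B: "\<And>y. norm (f y) \<le> B"
    and e: "\<And>s t. s \<in> {p..q} \<Longrightarrow> t \<in> {p..q} \<Longrightarrow> \<bar>g' s - g' t\<bar> \<le> e"
  shows "norm ((LINT y:g ` {p..q}|lborel. f y) -
    (LINT t:{p..q}|lborel. of_real \<bar>g' t\<bar> * f (g t))) \<le> 2 * B * e * (q - p)"
proof -
  have B0: "0 \<le> B" using norm_ge_zero order_trans B by blast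
  have e0: "0 \<le> e" using e[of p p] \<open>p \<le> q\<close> by auto
  show ?thesis
  proof (cases "\<exists>s\<in>{p..q}. g' s = 0")
    case True
    then obtain s where s: "s \<in> {p..q}" "g' s = 0" by blast
    then have le: "\<bar>g' t\<bar> \<le> e" if "t \<in> {p..q}" for t using e[OF that s(1)] by simp
    obtain c d where cd: "g ` {p..q} = {c..d}" "c \<le> d" "d - c \<le> e * (q - p)"
      using image_interval_lipschitz[OF \<open>p \<le> q\<close> der le] by blast
    have "norm (LINT y:{c..d}|lborel. f y) \<le> B * (d - c)"
      using norm_integral_interval_le[OF cd(2) B0 B] .
    also have "\<dots> \<le> B * (e * (q - p))" using B0 cd(3) by (rule mult_left_mono[rotated])
    finally have 1: "norm (LINT y:g ` {p..q}|lborel. f y) \<le> B * e * (q - p)"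
      using cd(1) by simp
    have "norm (LINT t:{p..q}|lborel. of_real \<bar>g' t\<bar> * f (g t)) \<le> e * B * (q - p)"
      using le B e0 B0 by (intro norm_integral_interval_le[OF \<open>p \<le> q\<close>])
        (auto simp: norm_mult intro!: mult_mono)
    with 1 show ?thesis
      by (intro order_trans[OF norm_triangle_ineq4]) (simp add: algebra_simps)
  next
    case False
    have "(\<forall>t\<in>{p..q}. 0 \<le> g' t) \<or> (\<forall>t\<in>{p..q}. g' t \<le> 0)"
    proof (rule ccontr)
      assume "\<not> ?thesis"
      then obtain s t where st: "s \<in> {p..q}" "t \<in> {p..q}" "g' s < 0" "0 < g' t"
        by (auto simp: not_le)
      have "connected (g' ` {p..q})" using cont(1) by (intro connected_continuous_image) auto
      then have "0 \<in> g' ` {p..q}"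
        using st by (auto simp: connected_iff_interval dest!: bspec[of _ _ "g' s"] bspec[of _ _ "g' t"])
      then show False using False by force
    qed
    from integral_image_fixed_sign[OF \<open>p \<le> q\<close> der cont this] show ?thesis
      using B0 e0 \<open>p \<le> q\<close> by simp
  qed
qed

section \<open>Summation over a uniform partition and passage to the limit\<close>

lemma set_integral_uniform_partition:
  fixes f :: "real \<Rightarrow> complex"
  assumes "a \<le> b" "0 < n" "set_integrable lborel {a..b} f"
  shows "(\<Sum>j<n. LINT t:{a + real j * ((b - a) / real n)..a + real (Suc j) * ((b - a) / real n)}|lborel. f t)
    = (LINT t:{a..b}|lborel. f t)"
proof -
  define h where "h = (b - a) / real n"
  have h: "0 \<le> h" "a + real n * h = b" using assms by (auto simp: h_def)
  have "(\<Sum>j<m. LINT t:{a + real j * h..a + real (Suc j) * h}|lborel. f t)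
      = (LINT t:{a..a + real m * h}|lborel. f t)" if "m \<le> n" for m
    using that
  proof (induction m)
    case 0
    show ?case using interval_integral_Icc[of a a f] by simp
  next
    case (Suc m)
    have mh: "real m * h \<le> real (Suc m) * h" "real (Suc m) * h \<le> real n * h" "0 \<le> real m * h"
      using Suc.prems h(1) by (auto intro!: mult_right_mono)
    have "set_integrable lborel {a..a + real (Suc m) * h} f"
      using mh h(2) by (intro set_integrable_subset[OF assms(3)]) auto
    then have int: "interval_lebesgue_integrable lborel (ereal a) (ereal (a + real (Suc m) * h)) f"
      using mh by (subst interval_integrable_endpoints_reverse, subst interval_integrable_endpoints_reverse)
        (auto simp: interval_lebesgue_integrable_def intro: set_integrable_subset)
    \<comment> \<open>Interval integrals do not see the endpoints that consecutive closed cells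
      share.\<close>
    have "(LBINT t=a..a + real m * h. f t) + (LBINT t=a + real m * h..a + real (Suc m) * h. f t)
        = (LBINT t=a..a + real (Suc m) * h. f t)"
      using int mh by (intro interval_integral_sum) (auto simp: min_def max_def)
    then show ?case
      using Suc mh by (simp add: interval_integral_Icc del: of_nat_Suc)
  qed
  from this[of n] show ?thesis using h(2) unfolding h_def by simp
qed

text \<open>A continuous image of a Borel set need not be Borel in general. Here it differs from the
  compact image of the closed interval by at most the point \<open>g q\<close>.\<close>

lemma image_atLeastLessThan_borel:
  fixes g :: "real \<Rightarrow> real"
  assumes "continuous_on {p..q} g"
  shows "g ` {p..<q} \<in> sets borel"
proof (cases "p \<le> q")
  case True
  have cl: "g ` {p..q} \<in> sets borel"
    using assms by (intro borel_closed compact_imp_closed compact_continuous_image) auto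
  have "{p..q} = insert q {p..<q}" using True by auto
  then have "g ` {p..<q} = (if g q \<in> g ` {p..<q} then g ` {p..q} else g ` {p..q} - {g q})" by auto
  then show ?thesis using cl by (metis borel_singleton sets.Diff sets.empty_sets)
qed auto

lemma level_cells_borel:
  assumes "a < b" "0 < n" "continuous_on {a..b} g"
  shows "(\<lambda>y. real (level_cells g a b n y)) \<in> borel_measurable borel"
proof -
  have "g ` {t \<in> {a..b}. cell a b n t = int j} \<in> sets borel" if "j \<le> n" for j
  proof (cases "j = n")
    case True
    then show ?thesis using cell_eq_last[OF assms(1,2)] by simp
  next
    case False
    then have j: "j < n" using that by simp
    let ?p = "a + real j * ((b - a) / real n)" and ?q = "a + real (Suc j) * ((b - a) / real n)"
    have "real (Suc j) * ((b - a) / real n) \<le> real n * ((b - a) / real n)"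
      using j assms(1) by (intro mult_right_mono) auto
    then have "{?p..?q} \<subseteq> {a..b}" using assms(1,2) by auto
    then show ?thesis unfolding cell_eq_interval[OF assms(1) j]
      by (intro image_atLeastLessThan_borel continuous_on_subset[OF assms(3)])
  qed
  then show ?thesis unfolding level_cells_eq_sum[OF assms(1)] by (intro borel_measurable_sum) auto
qed

text \<open>The error on one cell is proportional to its length, so the errors add up to a bound
  whose only dependence on \<open>n\<close> is through \<open>e\<close>, a bound for the oscillation
  of \<open>g'\<close> at the scale of the mesh.\<close>

lemma integral_level_cells_approx:
  fixes g g' :: "real \<Rightarrow> real" and f :: "real \<Rightarrow> complex"
  assumes "a < b" "0 < n"
    and der: "\<And>t. t \<in> {a..b} \<Longrightarrow> (g has_real_derivative g' t) (at t within {a..b})"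
    and cont: "continuous_on {a..b} g'" "continuous_on UNIV f"
    and B: "\<And>y. norm (f y) \<le> B"
    and e: "\<And>s t. s \<in> {a..b} \<Longrightarrow> t \<in> {a..b} \<Longrightarrow> \<bar>s - t\<bar> \<le> (b - a) / real n \<Longrightarrow> \<bar>g' s - g' t\<bar> \<le> e"
  shows "norm ((LINT y|lborel. of_nat (level_cells g a b n y) * f y) -
    (LINT t:{a..b}|lborel. of_real \<bar>g' t\<bar> * f (g t))) \<le> 2 * B * e * (b - a)"
proof -
  define P where "P j = a + real j * ((b - a) / real n)" for j
  have P: "a \<le> P j" "P j \<le> P (Suc j)" "P (Suc j) \<le> b" "P (Suc j) - P j = (b - a) / real n"
    if "j < n" for j
  proof -
    have "real (Suc j) * ((b - a) / real n) \<le> real n * ((b - a) / real n)"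
      using that assms(1) by (intro mult_right_mono) auto
    then show "P (Suc j) \<le> b" using assms(2) by (simp add: P_def)
  qed (use assms in \<open>auto simp: P_def distrib_right add_divide_distrib\<close>)
  have contg: "continuous_on {a..b} g"
    using der by (meson DERIV_continuous continuous_on_eq_continuous_within)
  have compact: "compact (g ` {P j..P (Suc j)})" if "j < n" for j
    using P[OF that] by (intro compact_continuous_image continuous_on_subset[OF contg]) auto
  have meas_im: "g ` {P j..P (Suc j)} \<in> sets borel" if "j < n" for j
    using compact[OF that] by (intro borel_closed compact_imp_closed)
  have [measurable]: "f \<in> borel_measurable borel"
    using cont(2) by (rule borel_measurable_continuous_onI)
  have AE_eq: "AE y in lborel. of_nat (level_cells g a b n y) * f y =
      (\<Sum>j<n. indicator (g ` {P j..P (Suc j)}) y *\<^sub>R f y)"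
  proof -
    \<comment> \<open>Away from the finitely many levels attained at grid points, half-open cells
      may be replaced by closed ones, and the one-point cell at \<open>b\<close> contributes
      nothing.\<close>
    have "AE y in lborel. y \<notin> g ` P ` {..n}"
      by (intro AE_not_in finite_imp_null_set_lborel) auto
    then show ?thesis
    proof eventually_elim
      case (elim y)
      have "indicator (g ` {t \<in> {a..b}. cell a b n t = int j}) y =
          (indicator (g ` {P j..P (Suc j)}) y :: real)" if "j < n" for j
      proof -
        have "{P j..P (Suc j)} = insert (P (Suc j)) {P j..<P (Suc j)}" using P(2)[OF that] by auto
        moreover have "y \<noteq> g (P (Suc j))" using elim that by auto
        ultimately show ?thesis unfolding cell_eq_interval[OF assms(1) that] P_def[symmetric]
          by (simp add: indicator_def)
      qed
      moreover have "P n = b" using assms(2) by (simp add: P_def)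
      then have "y \<noteq> g b" using elim by auto
      ultimately have "real (level_cells g a b n y) = (\<Sum>j<n. indicator (g ` {P j..P (Suc j)}) y)"
        unfolding level_cells_eq_sum[OF assms(1)]
        using cell_eq_last[OF assms(1,2)] by (simp flip: lessThan_Suc_atMost)
      then have "complex_of_real (real (level_cells g a b n y)) * f y =
          of_real (\<Sum>j<n. indicator (g ` {P j..P (Suc j)}) y) * f y"
        by simp
      then show ?case by (simp add: scaleR_conv_of_real sum_distrib_right)
    qed
  qed
  have int_im: "set_integrable lborel (g ` {P j..P (Suc j)}) f" if "j < n" for j
    unfolding set_integrable_def using compact[OF that] continuous_on_subset[OF cont(2)]
    by (intro borel_integrable_compact) auto
  have "(LINT y|lborel. of_nat (level_cells g a b n y) * f y) =
      (LINT y|lborel. (\<Sum>j<n. indicator (g ` {P j..P (Suc j)}) y *\<^sub>R f y))"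
  proof (rule integral_cong_AE[OF _ _ AE_eq])
    have "(\<lambda>y. complex_of_real (real (level_cells g a b n y)) * f y) \<in> borel_measurable lborel"
      using level_cells_borel[OF assms(1,2) contg] by measurable
    then show "(\<lambda>y. of_nat (level_cells g a b n y) * f y) \<in> borel_measurable lborel" by simp
  qed (use meas_im in auto)
  also have "\<dots> = (\<Sum>j<n. LINT y:g ` {P j..P (Suc j)}|lborel. f y)"
    unfolding set_lebesgue_integral_def using int_im
    by (intro Bochner_Integration.integral_sum) (auto simp: set_integrable_def)
  finally have 1: "(LINT y|lborel. of_nat (level_cells g a b n y) * f y) =
      (\<Sum>j<n. LINT y:g ` {P j..P (Suc j)}|lborel. f y)" .
  have "set_integrable lborel {a..b} (\<lambda>t. of_real \<bar>g' t\<bar> * f (g t))"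
    by (intro borel_integrable_atLeastAtMost' continuous_intros cont contg
        continuous_on_compose2[OF cont(2)]) auto
  then have 2: "(LINT t:{a..b}|lborel. of_real \<bar>g' t\<bar> * f (g t)) =
      (\<Sum>j<n. LINT t:{P j..P (Suc j)}|lborel. of_real \<bar>g' t\<bar> * f (g t))"
    unfolding P_def using assms(1,2) by (intro set_integral_uniform_partition[symmetric]) auto
  have "norm ((LINT y:g ` {P j..P (Suc j)}|lborel. f y) -
      (LINT t:{P j..P (Suc j)}|lborel. of_real \<bar>g' t\<bar> * f (g t)))
      \<le> 2 * B * e * (P (Suc j) - P j)" if "j < n" for j
  proof (rule integral_image_approx[OF P(2)[OF that] _ _ cont(2) B])
    show "(g has_real_derivative g' t) (at t within {P j..P (Suc j)})"
      if "t \<in> {P j..P (Suc j)}" for t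
      using P[OF \<open>j < n\<close>] that by (intro DERIV_subset[OF der]) auto
    show "continuous_on {P j..P (Suc j)} g'"
      using P[OF \<open>j < n\<close>] by (intro continuous_on_subset[OF cont(1)]) auto
    show "\<bar>g' s - g' t\<bar> \<le> e" if "s \<in> {P j..P (Suc j)}" "t \<in> {P j..P (Suc j)}" for s t
      using P[OF \<open>j < n\<close>] that by (intro e) auto
  qed
  then have "norm (\<Sum>j<n. (LINT y:g ` {P j..P (Suc j)}|lborel. f y) -
      (LINT t:{P j..P (Suc j)}|lborel. of_real \<bar>g' t\<bar> * f (g t)))
      \<le> (\<Sum>j<n. 2 * B * e * (P (Suc j) - P j))"
    by (intro sum_norm_le) auto
  also have "\<dots> = (\<Sum>j<n. 2 * B * e * ((b - a) / real n))"
    using P(4) by (intro sum.cong) auto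
  also have "\<dots> = 2 * B * e * (b - a)" using assms(2) by simp
  finally show ?thesis unfolding 1 2 by (simp add: sum_subtractf)
qed

lemma integral_level_cells_tendsto:
  fixes g g' :: "real \<Rightarrow> real" and f :: "real \<Rightarrow> complex"
  assumes "a < b"
    and der: "\<And>t. t \<in> {a..b} \<Longrightarrow> (g has_real_derivative g' t) (at t within {a..b})"
    and cont: "continuous_on {a..b} g'" "continuous_on UNIV f"
    and B: "\<And>y. norm (f y) \<le> B"
  shows "(\<lambda>n. LINT y|lborel. of_nat (level_cells g a b n y) * f y) \<longlonglongrightarrow>
    (LINT t:{a..b}|lborel. of_real \<bar>g' t\<bar> * f (g t))"
proof (rule tendstoI)
  fix r :: real assume "0 < r"
  have B0: "0 \<le> B" using norm_ge_zero order_trans B by blast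
  \<comment> \<open>The tolerance for the oscillation of \<open>g'\<close>, chosen so that
    \<open>2 * B * e * (b - a)\<close> is below \<open>r\<close>; \<open>B + 1\<close> keeps the
    denominator positive when \<open>B = 0\<close>.\<close>
  define e where "e = r / (4 * (B + 1) * (b - a))"
  have e: "0 < e" using \<open>0 < r\<close> B0 assms(1) by (simp add: e_def)
  have "4 * (B + 1) * (b - a) * e = r" using B0 assms(1) by (simp add: e_def)
  moreover have "2 * B * e * (b - a) < 4 * (B + 1) * (b - a) * e"
  proof -
    have "0 < e * (b - a)" using e assms(1) by simp
    then have "2 * B * (e * (b - a)) < 4 * (B + 1) * (e * (b - a))"
      using B0 by (intro mult_strict_right_mono) auto
    then show ?thesis by (simp add: mult_ac)
  qed
  ultimately have er: "2 * B * e * (b - a) < r" by simp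
  have "uniformly_continuous_on {a..b} g'"
    using cont(1) by (intro compact_uniformly_continuous) auto
  then obtain d where d: "0 < d"
    "\<And>s t. s \<in> {a..b} \<Longrightarrow> t \<in> {a..b} \<Longrightarrow> dist s t < d \<Longrightarrow> dist (g' s) (g' t) < e"
    unfolding uniformly_continuous_on_def using e by metis
  have "(\<lambda>n. (b - a) / real n) \<longlonglongrightarrow> 0" by (rule lim_const_over_n)
  then have "\<forall>\<^sub>F n in sequentially. (b - a) / real n < d" using d(1) by (rule order_tendstoD)
  then show "\<forall>\<^sub>F n in sequentially. dist (LINT y|lborel. of_nat (level_cells g a b n y) * f y)
      (LINT t:{a..b}|lborel. of_real \<bar>g' t\<bar> * f (g t)) < r"
    using eventually_gt_at_top[of 0]
  proof eventually_elim
    case (elim n)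
    have "\<bar>g' s - g' t\<bar> \<le> e"
      if "s \<in> {a..b}" "t \<in> {a..b}" "\<bar>s - t\<bar> \<le> (b - a) / real n" for s t
      using d(2)[OF that(1,2)] that(3) elim by (simp add: dist_real_def)
    from integral_level_cells_approx[OF assms(1) elim(2) der cont B this]
    show ?case using er by (simp add: dist_norm)
  qed
qed

text \<open>The proof has two stages. With \<open>f = 1\<close> it yields, by Fatou from above and
  \<open>level_cells_le\<close> from below, that the number of crossings has a finite integral over
  all levels. It can then serve as the dominating function for the cell counts when \<open>f\<close>
  is an arbitrary bounded continuous function.\<close>

lemma
  fixes g g' :: "real \<Rightarrow> real"
  assumes "a < b"
    and der: "\<And>t. t \<in> {a..b} \<Longrightarrow> (g has_real_derivative g' t) (at t within {a..b})"
    and cont: "continuous_on {a..b} g'"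
  shows nn_integral_level_count:
      "(\<integral>\<^sup>+y. emeasure (count_space UNIV) {t \<in> {a..b}. g t = y} \<partial>lborel) =
        (\<integral>\<^sup>+t\<in>{a..b}. ennreal \<bar>g' t\<bar> \<partial>lborel)" (is ?nn)
    and integral_level_count:
      "\<And>f :: real \<Rightarrow> complex. continuous_on UNIV f \<Longrightarrow> (\<And>y. norm (f y) \<le> B) \<Longrightarrow>
        (LINT y|lborel. of_real (enn2real (emeasure (count_space UNIV) {t \<in> {a..b}. g t = y})) * f y) =
        (LINT t:{a..b}|lborel. of_real \<bar>g' t\<bar> * f (g t))"
proof -
  let ?N = "\<lambda>y. emeasure (count_space UNIV) {t \<in> {a..b}. g t = y}"
  \<comment> \<open>The shift by one excludes the partition with \<open>n = 0\<close>, which has no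
    mesh.\<close>
  let ?c = "\<lambda>n y. real (level_cells g a b (Suc n) y)"
  have contg: "continuous_on {a..b} g"
    using der by (meson DERIV_continuous continuous_on_eq_continuous_within)
  have [measurable]: "?c n \<in> borel_measurable borel" for n
    using level_cells_borel[OF assms(1) _ contg] by simp
  have lim: "(\<lambda>n. ennreal (?c n y)) \<longlonglongrightarrow> ?N y" for y
    using LIMSEQ_Suc[OF level_cells_tendsto[OF assms(1), of g y]] by (simp add: ennreal_of_nat_eq_real_of_nat)
  have le: "ennreal (?c n y) \<le> ?N y" for n y
    using level_cells_le[OF assms(1), of g "Suc n" y] by (simp add: ennreal_of_nat_eq_real_of_nat)
  have meas[measurable]: "?N \<in> borel_measurable borel"
    by (rule borel_measurable_LIMSEQ_order[where u = "\<lambda>n y. ennreal (?c n y)"]) (use lim in auto)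
  have c_int: "integrable lborel (?c n)" for n
  proof (rule Bochner_Integration.integrable_bound)
    have "compact (g ` {a..b})" using contg by (intro compact_continuous_image) auto
    \<comment> \<open>Indices run from 0 to \<open>Suc n\<close>, including the extra cell at
      \<open>b\<close>, so at most \<open>n + 2\<close> cells are occupied.\<close>
    then show "integrable lborel (\<lambda>y. indicator (g ` {a..b}) y *\<^sub>R (real n + 2))"
      by (intro borel_integrable_compact) auto
    have "?c n y \<le> indicator (g ` {a..b}) y *\<^sub>R (real n + 2)" for y
    proof (cases "y \<in> g ` {a..b}")
      case True
      have "?c n y \<le> (\<Sum>j\<le>Suc n. 1)"
        unfolding level_cells_eq_sum[OF assms(1)] by (intro sum_mono) (simp add: indicator_def)
      then show ?thesis using True by simp
    next
      case False
      then have "{t \<in> {a..b}. g t = y} = {}" by auto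
      then show ?thesis by (simp only: level_cells_def image_empty card.empty) simp
    qed
    then show "AE y in lborel. norm (?c n y) \<le> norm (indicator (g ` {a..b}) y *\<^sub>R (real n + 2))"
      by (intro always_eventually allI) simp
  qed simp
  define R where "R = (LINT t:{a..b}|lborel. \<bar>g' t\<bar>)"
  have "(\<lambda>n. LINT y|lborel. of_nat (level_cells g a b n y) * (1::complex)) \<longlonglongrightarrow>
      (LINT t:{a..b}|lborel. of_real \<bar>g' t\<bar> * 1)"
    by (rule integral_level_cells_tendsto[OF assms, where B = 1]) auto
  from LIMSEQ_Suc[OF this] have "(\<lambda>n. complex_of_real (LINT y|lborel. ?c n y)) \<longlonglongrightarrow> of_real R"
    unfolding R_def set_lebesgue_integral_def integral_complex_of_real[symmetric]
    by (simp add: scaleR_conv_of_real)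
  then have "(\<lambda>n. LINT y|lborel. ?c n y) \<longlonglongrightarrow> R" by (rule tendsto_of_real_iff[THEN iffD1])
  then have lim_R: "(\<lambda>n. \<integral>\<^sup>+y. ennreal (?c n y) \<partial>lborel) \<longlonglongrightarrow> ennreal R"
    using c_int by (simp add: nn_integral_eq_integral)
  have "(\<integral>\<^sup>+y. ?N y \<partial>lborel) = (\<integral>\<^sup>+y. liminf (\<lambda>n. ennreal (?c n y)) \<partial>lborel)"
    by (simp only: lim_imp_Liminf[OF trivial_limit_sequentially lim])
  also have "\<dots> \<le> liminf (\<lambda>n. \<integral>\<^sup>+y. ennreal (?c n y) \<partial>lborel)"
    by (intro nn_integral_liminf) simp
  also have "\<dots> = ennreal R" using lim_R by (rule lim_imp_Liminf[OF trivial_limit_sequentially])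
  finally have "(\<integral>\<^sup>+y. ?N y \<partial>lborel) \<le> ennreal R" .
  moreover have "ennreal R \<le> (\<integral>\<^sup>+y. ?N y \<partial>lborel)"
    by (rule LIMSEQ_le_const2[OF lim_R]) (use le in \<open>auto intro!: nn_integral_mono\<close>)
  moreover have "ennreal R = (\<integral>\<^sup>+t\<in>{a..b}. ennreal \<bar>g' t\<bar> \<partial>lborel)"
  proof -
    have "set_integrable lborel {a..b} (\<lambda>t. \<bar>g' t\<bar>)"
      by (intro borel_integrable_atLeastAtMost' continuous_intros cont)
    then show ?thesis
      unfolding R_def set_lebesgue_integral_def set_integrable_def
      by (subst nn_integral_eq_integral[symmetric])
        (auto intro!: nn_integral_cong simp: indicator_def)
  qed
  ultimately show nn: ?nn by simp
  have N_R: "(\<integral>\<^sup>+y. ?N y \<partial>lborel) = ennreal R"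
    using \<open>(\<integral>\<^sup>+y. ?N y \<partial>lborel) \<le> ennreal R\<close> \<open>ennreal R \<le> (\<integral>\<^sup>+y. ?N y \<partial>lborel)\<close> by simp
  then have "(\<integral>\<^sup>+y. ?N y \<partial>lborel) \<noteq> \<infinity>" by simp
  from nn_integral_noteq_infinite[OF _ this] have fin: "AE y in lborel. ?N y \<noteq> \<infinity>"
    using meas by simp
  have "(\<integral>\<^sup>+y. ennreal (enn2real (?N y)) \<partial>lborel) = (\<integral>\<^sup>+y. ?N y \<partial>lborel)"
    using fin by (intro nn_integral_cong_AE) (auto simp: less_top)
  moreover have "(\<lambda>y. enn2real (?N y)) \<in> borel_measurable lborel" by measurable
  ultimately have N_int: "integrable lborel (\<lambda>y. enn2real (?N y))"
    using N_R by (intro integrableI_nonneg) auto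
  fix f :: "real \<Rightarrow> complex"
  assume f: "continuous_on UNIV f" "\<And>y. norm (f y) \<le> B"
  have [measurable]: "f \<in> borel_measurable borel"
    using f(1) by (rule borel_measurable_continuous_onI)
  have "(\<lambda>n. LINT y|lborel. of_real (?c n y) * f y) \<longlonglongrightarrow> (LINT y|lborel. of_real (enn2real (?N y)) * f y)"
  proof (rule integral_dominated_convergence)
    show "integrable lborel (\<lambda>y. enn2real (?N y) * B)" using N_int by simp
    \<comment> \<open>\<open>enn2real\<close> sends infinity to 0, so convergence and domination are
      claimed only at levels with finitely many crossings, which are almost all.\<close>
    show "AE y in lborel. (\<lambda>n. of_real (?c n y) * f y) \<longlonglongrightarrow> of_real (enn2real (?N y)) * f y"
      using fin
    proof eventually_elim
      case (elim y)
      have "(\<lambda>n. enn2real (ennreal (?c n y))) \<longlonglongrightarrow> enn2real (?N y)"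
        using lim elim by (intro tendsto_enn2real) (auto simp: less_top)
      then show ?case by (intro tendsto_intros) simp
    qed
    show "AE y in lborel. norm (of_real (?c n y) * f y) \<le> enn2real (?N y) * B" for n
      using fin
    proof eventually_elim
      case (elim y)
      have "?c n y \<le> enn2real (?N y)"
        using enn2real_mono[OF le[of n y]] elim by (simp add: less_top)
      then show ?case using f(2)[of y] by (simp add: norm_mult mult_mono)
    qed
  qed measurable
  moreover have "(\<lambda>n. LINT y|lborel. of_real (?c n y) * f y) \<longlonglongrightarrow>
      (LINT t:{a..b}|lborel. of_real \<bar>g' t\<bar> * f (g t))"
    using LIMSEQ_Suc[OF integral_level_cells_tendsto[OF assms f]] by simp
  ultimately show "(LINT y|lborel. of_real (enn2real (?N y)) * f y) =
      (LINT t:{a..b}|lborel. of_real \<bar>g' t\<bar> * f (g t))"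
    by (rule LIMSEQ_unique)
qed

section \<open>Measurability of the number of crossings\<close>

lemma floor_divide_tendsto:
  "(\<lambda>n. of_int \<lfloor>real (Suc n) * x\<rfloor> / real (Suc n)) \<longlonglongrightarrow> x"
proof (rule LIMSEQ_I)
  fix r :: real assume "0 < r"
  then obtain N where N: "inverse (real (Suc N)) < r" using reals_Archimedean by blast
  have "norm (of_int \<lfloor>real (Suc n) * x\<rfloor> / real (Suc n) - x) < r" if "N \<le> n" for n
  proof -
    have "\<bar>of_int \<lfloor>real (Suc n) * x\<rfloor> - real (Suc n) * x\<bar> \<le> 1" by linarith
    then have "\<bar>of_int \<lfloor>real (Suc n) * x\<rfloor> - real (Suc n) * x\<bar> / real (Suc n) \<le> 1 / real (Suc n)"
      by (intro divide_right_mono) auto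
    also have "\<dots> \<le> 1 / real (Suc N)" using that by (intro divide_left_mono) auto
    also have "\<dots> < r" using N by (simp add: inverse_eq_divide)
    also have "\<bar>of_int \<lfloor>real (Suc n) * x\<rfloor> - real (Suc n) * x\<bar> / real (Suc n) =
        \<bar>(of_int \<lfloor>real (Suc n) * x\<rfloor> - real (Suc n) * x) / real (Suc n)\<bar>"
      by (simp del: of_nat_Suc)
    also have "(of_int \<lfloor>real (Suc n) * x\<rfloor> - real (Suc n) * x) / real (Suc n) =
        of_int \<lfloor>real (Suc n) * x\<rfloor> / real (Suc n) - x"
      by (simp add: diff_divide_distrib del: of_nat_Suc)
    finally have "\<bar>of_int \<lfloor>real (Suc n) * x\<rfloor> / real (Suc n) - x\<bar> < r" .
    then show ?thesis by simp
  qed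
  then show "\<exists>N. \<forall>n\<ge>N. norm (of_int \<lfloor>real (Suc n) * x\<rfloor> / real (Suc n) - x) < r" by blast
qed

text \<open>Sampling the path at the time rounded down to a multiple of \<open>1 / Suc n\<close>
  uses only countably many random variables, so each sampled process is jointly measurable;
  continuity of the paths makes these processes converge pointwise.\<close>

lemma borel_measurable_continuous_paths:
  fixes f :: "real \<Rightarrow> 'w \<Rightarrow> real"
  assumes [measurable]: "\<And>t. f t \<in> borel_measurable M"
    and cont: "\<And>w. w \<in> space M \<Longrightarrow> continuous_on UNIV (\<lambda>t. f t w)"
  shows "(\<lambda>(t, w). f t w) \<in> borel_measurable (borel \<Otimes>\<^sub>M M)"
proof (rule borel_measurable_LIMSEQ_metric)
  show "(\<lambda>(t, w). f (of_int \<lfloor>real (Suc n) * t\<rfloor> / real (Suc n)) w) \<in> borel_measurable (borel \<Otimes>\<^sub>M M)" for n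
  proof -
    have "(\<lambda>x. (\<lambda>i x. f (of_int i / real (Suc n)) (snd x)) \<lfloor>real (Suc n) * fst x\<rfloor> x)
        \<in> borel_measurable (borel \<Otimes>\<^sub>M M)"
      by (rule measurable_compose_countable) measurable
    then show ?thesis by (simp add: case_prod_beta)
  qed
  fix x :: "real \<times> 'w" assume "x \<in> space (borel \<Otimes>\<^sub>M M)"
  then have "isCont (\<lambda>t. f t (snd x)) (fst x)"
    using cont[of "snd x"] by (auto simp: space_pair_measure continuous_on_eq_continuous_at)
  from isCont_tendsto_compose[OF this floor_divide_tendsto]
  show "(\<lambda>n. case x of (t, w) \<Rightarrow> f (of_int \<lfloor>real (Suc n) * t\<rfloor> / real (Suc n)) w) \<longlonglongrightarrow>
      (case x of (t, w) \<Rightarrow> f t w)"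
    by (simp add: case_prod_beta)
qed

text \<open>
  The right-hand side involves only countable quantifiers, hence is measurable jointly in the level
  and the outcome when \<open>f\<close> is a path of a process.
\<close>

lemma mem_image_interval_iff_grid:
  fixes f :: "real \<Rightarrow> real"
  assumes "p \<le> q" "continuous_on UNIV f"
  shows "y \<in> f ` {p..q} \<longleftrightarrow>
    (\<forall>m. \<exists>n i. i \<le> Suc n \<and> \<bar>f (p + (q - p) * (real i / real (Suc n))) - y\<bar> < 1 / real (Suc m))"
proof
  assume "y \<in> f ` {p..q}"
  then obtain t where t: "t \<in> {p..q}" "y = f t" by blast
  \<comment> \<open>For \<open>p = q\<close> the quotient is 0 by convention, and
    \<open>t = p\<close> still has the required form.\<close>
  define x where "x = (t - p) / (q - p)"
  have x: "0 \<le> x" "x \<le> 1" using t(1) by (auto simp: x_def divide_le_eq)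
  have tx: "t = p + (q - p) * x" using t(1) by (cases "p = q") (auto simp: x_def)
  have "isCont f (p + (q - p) * x)" using assms(2) by (simp add: continuous_on_eq_continuous_at)
  then have "isCont (\<lambda>x. f (p + (q - p) * x)) x"
    by (rule isCont_o2[rotated]) (intro continuous_intros)
  from isCont_tendsto_compose[OF this floor_divide_tendsto]
  have lim: "(\<lambda>n. f (p + (q - p) * (of_int \<lfloor>real (Suc n) * x\<rfloor> / real (Suc n)))) \<longlonglongrightarrow> y"
    unfolding t(2) tx .
  show "\<forall>m. \<exists>n i. i \<le> Suc n \<and> \<bar>f (p + (q - p) * (real i / real (Suc n))) - y\<bar> < 1 / real (Suc m)"
  proof
    fix m
    obtain n where n: "\<bar>f (p + (q - p) * (of_int \<lfloor>real (Suc n) * x\<rfloor> / real (Suc n))) - y\<bar> < 1 / real (Suc m)"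
      using LIMSEQ_D[OF lim, of "1 / real (Suc m)"] by (auto simp del: of_nat_Suc)
    have "0 \<le> real (Suc n) * x" "real (Suc n) * x \<le> real (Suc n)"
      using x by (simp_all add: mult_left_le del: of_nat_Suc)
    then have "0 \<le> \<lfloor>real (Suc n) * x\<rfloor>" "\<lfloor>real (Suc n) * x\<rfloor> \<le> int (Suc n)" by linarith+
    then show "\<exists>n i. i \<le> Suc n \<and> \<bar>f (p + (q - p) * (real i / real (Suc n))) - y\<bar> < 1 / real (Suc m)"
      using n by (intro exI[of _ n] exI[of _ "nat \<lfloor>real (Suc n) * x\<rfloor>"]) auto
  qed
next
  assume *: "\<forall>m. \<exists>n i. i \<le> Suc n \<and> \<bar>f (p + (q - p) * (real i / real (Suc n))) - y\<bar> < 1 / real (Suc m)"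
  \<comment> \<open>The grid condition yields only approximate solutions of \<open>f t = y\<close>;
    closedness of the compact image turns them into an exact one.\<close>
  have "compact (f ` {p..q})"
    using assms(2) by (intro compact_continuous_image continuous_on_subset[OF assms(2)]) auto
  then have closed: "closed (f ` {p..q})" by (rule compact_imp_closed)
  have "\<exists>z\<in>f ` {p..q}. dist z y < e" if e: "0 < e" for e
  proof -
    obtain m where m: "1 / real (Suc m) < e"
      using reals_Archimedean[OF e] by (auto simp: inverse_eq_divide)
    obtain n i where ni: "i \<le> Suc n" "\<bar>f (p + (q - p) * (real i / real (Suc n))) - y\<bar> < 1 / real (Suc m)"
      using * by blast
    have "(q - p) * (real i / real (Suc n)) \<le> (q - p) * 1"
      using assms(1) ni(1) by (intro mult_left_mono) (auto simp: divide_le_eq)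
    then have "p + (q - p) * (real i / real (Suc n)) \<in> {p..q}" using assms(1) by auto
    moreover have "dist (f (p + (q - p) * (real i / real (Suc n)))) y < e"
      unfolding dist_real_def using ni(2) m by (rule less_trans)
    ultimately show ?thesis by blast
  qed
  then show "y \<in> f ` {p..q}" using closed by (metis closed_approachable)
qed

text \<open>A half-open cell is a countable union of closed intervals, and the grid criterion is
  available only for the latter.\<close>

lemma mem_image_half_open_iff:
  fixes f :: "real \<Rightarrow> real"
  assumes "p < q"
  shows "y \<in> f ` {p..<q} \<longleftrightarrow> (\<exists>n. y \<in> f ` {p..q - (q - p) / real (Suc n)})"
proof
  assume "y \<in> f ` {p..<q}"
  then obtain t where t: "p \<le> t" "t < q" "y = f t" by auto
  obtain n where "inverse (real (Suc n)) < (q - t) / (q - p)"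
    using reals_Archimedean[of "(q - t) / (q - p)"] t assms by auto
  then have "(q - p) / real (Suc n) < q - t"
    using assms by (simp add: pos_less_divide_eq inverse_eq_divide del: of_nat_Suc)
  then show "\<exists>n. y \<in> f ` {p..q - (q - p) / real (Suc n)}"
    using t by (intro exI[of _ n]) auto
next
  assume "\<exists>n. y \<in> f ` {p..q - (q - p) / real (Suc n)}"
  then obtain n t where t: "p \<le> t" "t \<le> q - (q - p) / real (Suc n)" "y = f t" by auto
  moreover have "0 < (q - p) / real (Suc n)" using assms by simp
  ultimately show "y \<in> f ` {p..<q}" by (intro image_eqI[of _ _ t]) auto
qed

text \<open>\<open>level_cells_borel\<close> treats one fixed path; Tonelli needs measurability in
  the pair of level and outcome. The event that a cell attains the level is described by countably
  many values of the process, and the crossings are the limit of the resulting counts.\<close>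

lemma borel_measurable_crossings:
  fixes Y :: "real \<Rightarrow> 'w \<Rightarrow> real"
  assumes "a < b" and [measurable]: "\<And>t. Y t \<in> borel_measurable M"
    and cont: "\<And>w. w \<in> space M \<Longrightarrow> continuous_on UNIV (\<lambda>t. Y t w)"
  shows "(\<lambda>(y, w). crossings Y a b y w) \<in> borel_measurable (borel \<Otimes>\<^sub>M M)"
proof -
  let ?P = "borel \<Otimes>\<^sub>M M"
  have Icc: "Measurable.pred ?P (\<lambda>x. fst x \<in> (\<lambda>t. Y t (snd x)) ` {p..q})" if "p \<le> q" for p q
  proof -
    have "Measurable.pred ?P (\<lambda>x. \<forall>m. \<exists>n i. i \<le> Suc n \<and>
        \<bar>Y (p + (q - p) * (real i / real (Suc n))) (snd x) - fst x\<bar> < 1 / real (Suc m))"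
      by measurable
    moreover have "(fst x \<in> (\<lambda>t. Y t (snd x)) ` {p..q}) = (\<forall>m. \<exists>n i. i \<le> Suc n \<and>
        \<bar>Y (p + (q - p) * (real i / real (Suc n))) (snd x) - fst x\<bar> < 1 / real (Suc m))"
      if "x \<in> space ?P" for x
      using that by (intro mem_image_interval_iff_grid[OF \<open>p \<le> q\<close> cont]) (auto simp: space_pair_measure)
    ultimately show ?thesis by (subst measurable_cong) 
  qed
  have Ico: "Measurable.pred ?P (\<lambda>x. fst x \<in> (\<lambda>t. Y t (snd x)) ` {p..<q})" if "p < q" for p q
  proof -
    have "p \<le> q - (q - p) / real (Suc n)" for n
      using that mult_left_mono[of 1 "real (Suc n)" "q - p"] by (simp add: field_simps)
    then show ?thesis unfolding mem_image_half_open_iff[OF that]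
      using Icc by (intro pred_intros_countable) blast
  qed
  have cell: "Measurable.pred ?P (\<lambda>x. fst x \<in> (\<lambda>t. Y t (snd x)) ` {t \<in> {a..b}. cell a b (Suc n) t = int j})"
    if "j \<le> Suc n" for n j
  proof (cases "j = Suc n")
    case True
    then show ?thesis using cell_eq_last[OF assms(1), of "Suc n"] by simp
  next
    case False
    then have j: "j < Suc n" using that by simp
    show ?thesis unfolding cell_eq_interval[OF assms(1) j]
      using assms(1) by (intro Ico) (simp add: divide_strict_right_mono)
  qed
  have meas: "(\<lambda>x. ennreal (real (level_cells (\<lambda>t. Y t (snd x)) a b (Suc n) (fst x)))) \<in> borel_measurable ?P" for n
    unfolding level_cells_eq_sum[OF assms(1)] indicator_def of_bool_def
    by (intro measurable_compose[OF _ measurable_ennreal] borel_measurable_sum measurable_If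
        borel_measurable_const predE[OF cell[OF atMost_iff[THEN iffD1]]])
  have lim: "(\<lambda>n. ennreal (real (level_cells (\<lambda>t. Y t (snd x)) a b (Suc n) (fst x)))) \<longlonglongrightarrow>
      (case x of (y, w) \<Rightarrow> crossings Y a b y w)" for x
    using LIMSEQ_Suc[OF level_cells_tendsto[OF assms(1), of "\<lambda>t. Y t (snd x)" "fst x"]]
    by (simp add: ennreal_of_nat_eq_real_of_nat crossings_def case_prod_beta)
  show ?thesis by (rule borel_measurable_LIMSEQ_order[OF lim meas])
qed

section \<open>Mean square derivatives\<close>

lemma obtain_sequence_in_interval:
  fixes t :: real
  assumes "a < b" "t \<in> {a..b}"
  obtains s where "\<And>n. s n \<in> {a..b}" "\<And>n. s n \<noteq> t" "s \<longlonglongrightarrow> t"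
proof -
  have "t islimpt {a..b}" using assms by simp
  then obtain s where "\<forall>n. s n \<in> {a..b} - {t}" "s \<longlonglongrightarrow> t"
    unfolding islimpt_sequential by blast
  then show thesis using that[of s] by simp
qed

lemma has_real_derivative_sequence:
  assumes "(f has_real_derivative D) (at t within S)" "s \<longlonglongrightarrow> t" "\<And>n. s n \<in> S" "\<And>n. s n \<noteq> t"
  shows "(\<lambda>n. (f (s n) - f t) / (s n - t)) \<longlonglongrightarrow> D"
proof -
  have "filterlim s (at t within S) sequentially"
    using assms(2-4) by (auto simp: filterlim_at)
  then show ?thesis using assms(1)[unfolded has_field_derivative_iff] by (rule filterlim_compose[rotated])
qed

text \<open>A single sequence of times, chosen independently of the outcome, exhibits
  \<open>Z\<close> as a pointwise limit of difference quotients, which are random variables.\<close>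

lemma borel_measurable_path_derivative:
  fixes Y :: "real \<Rightarrow> 'w \<Rightarrow> real"
  assumes "a < b" "t \<in> {a..b}" and meas: "\<And>s. s \<in> {a..b} \<Longrightarrow> Y s \<in> borel_measurable M"
    and der: "\<And>w. w \<in> space M \<Longrightarrow> ((\<lambda>s. Y s w) has_real_derivative Z w) (at t within {a..b})"
  shows "Z \<in> borel_measurable M"
proof -
  obtain s where s: "\<And>n. s n \<in> {a..b}" "\<And>n. s n \<noteq> t" "s \<longlonglongrightarrow> t"
    using obtain_sequence_in_interval[OF assms(1,2)] by metis
  show ?thesis
    by (rule borel_measurable_LIMSEQ_real[OF has_real_derivative_sequence[OF der s(3,1,2)]])
      (use meas[OF s(1)] meas[OF assms(2)] in measurable)
qed

lemma square_integrable_diff: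
  assumes "square_integrable M f" "square_integrable M g"
  shows "square_integrable M (\<lambda>w. f w - g w)"
proof -
  have [measurable]: "f \<in> borel_measurable M" "g \<in> borel_measurable M"
    and sq: "integrable M (\<lambda>w. (f w)\<^sup>2)" "integrable M (\<lambda>w. (g w)\<^sup>2)"
    using assms by (auto simp: square_integrable_def)
  have le: "(x - y)\<^sup>2 \<le> 2 * x\<^sup>2 + 2 * y\<^sup>2" for x y :: real
    using zero_le_power2[of "x + y"] by (simp add: power2_diff power2_sum)
  have "integrable M (\<lambda>w. (f w - g w)\<^sup>2)"
  proof (rule Bochner_Integration.integrable_bound)
    show "integrable M (\<lambda>w. 2 * (f w)\<^sup>2 + 2 * (g w)\<^sup>2)" using sq by simp
    show "AE w in M. norm ((f w - g w)\<^sup>2) \<le> norm (2 * (f w)\<^sup>2 + 2 * (g w)\<^sup>2)"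
      unfolding real_norm_def abs_power2
      by (intro AE_I2 order_trans[OF le abs_ge_self])
  qed measurable
  then show ?thesis by (simp add: square_integrable_def)
qed

lemma square_integrable_divide:
  assumes "square_integrable M f"
  shows "square_integrable M (\<lambda>w. f w / c)"
  using assms by (auto simp: square_integrable_def power_divide)

text \<open>Along a sequence of times tending to \<open>t\<close>, the difference quotients tend to
  \<open>Z\<close> almost surely and to \<open>D\<close> in mean square. By Fatou the expectation of
  \<open>(Z - D)\<^sup>2\<close> is at most the limit of the mean square errors, which is 0.\<close>

lemma AE_eq_mean_square_derivative:
  fixes X :: "real \<Rightarrow> 'w \<Rightarrow> real"
  assumes "a < b" "t \<in> {a..b}" and sq: "\<And>s. s \<in> {a..b} \<Longrightarrow> square_integrable M (X s)"
    and D: "square_integrable M D"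
    and lim: "((\<lambda>s. \<integral>w. ((X s w - X t w) / (s - t) - D w)\<^sup>2 \<partial>M) \<longlongrightarrow> 0) (at t within {a..b})"
    and [measurable]: "Z \<in> borel_measurable M"
    and der: "AE w in M. ((\<lambda>s. X s w) has_real_derivative Z w) (at t within {a..b})"
  shows "AE w in M. Z w = D w"
proof -
  obtain s where s: "\<And>n. s n \<in> {a..b}" "\<And>n. s n \<noteq> t" "s \<longlonglongrightarrow> t"
    using obtain_sequence_in_interval[OF assms(1,2)] by metis
  define q where "q n w = (X (s n) w - X t w) / (s n - t) - D w" for n w
  have q: "square_integrable M (q n)" for n
    unfolding q_def[abs_def]
    by (intro square_integrable_diff square_integrable_divide sq s assms(2) D)
  then have [measurable]: "q n \<in> borel_measurable M" and q_int: "integrable M (\<lambda>w. (q n w)\<^sup>2)" for n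
    by (auto simp: square_integrable_def)
  have [measurable]: "D \<in> borel_measurable M" using D by (simp add: square_integrable_def)
  have "filterlim s (at t within {a..b}) sequentially"
    using s by (auto simp: filterlim_at)
  from filterlim_compose[OF lim this] have "(\<lambda>n. \<integral>w. (q n w)\<^sup>2 \<partial>M) \<longlonglongrightarrow> 0"
    by (simp add: q_def)
  then have "(\<lambda>n. ennreal (\<integral>w. (q n w)\<^sup>2 \<partial>M)) \<longlonglongrightarrow> ennreal 0" by (rule tendsto_ennrealI)
  then have lim0: "(\<lambda>n. \<integral>\<^sup>+w. ennreal ((q n w)\<^sup>2) \<partial>M) \<longlonglongrightarrow> 0"
    using q_int by (simp add: nn_integral_eq_integral)
  have "(\<integral>\<^sup>+w. ennreal ((Z w - D w)\<^sup>2) \<partial>M) = (\<integral>\<^sup>+w. liminf (\<lambda>n. ennreal ((q n w)\<^sup>2)) \<partial>M)"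
  proof (rule nn_integral_cong_AE)
    show "AE w in M. ennreal ((Z w - D w)\<^sup>2) = liminf (\<lambda>n. ennreal ((q n w)\<^sup>2))"
      using der
    proof eventually_elim
      case (elim w)
      have "(\<lambda>n. ennreal ((q n w)\<^sup>2)) \<longlonglongrightarrow> ennreal ((Z w - D w)\<^sup>2)"
        unfolding q_def by (intro tendsto_ennrealI tendsto_intros has_real_derivative_sequence[OF elim s(3,1,2)])
      from lim_imp_Liminf[OF trivial_limit_sequentially this] show ?case by simp
    qed
  qed
  also have "\<dots> \<le> liminf (\<lambda>n. \<integral>\<^sup>+w. ennreal ((q n w)\<^sup>2) \<partial>M)"
    by (intro nn_integral_liminf) measurable
  also have "\<dots> = 0" by (rule lim_imp_Liminf[OF trivial_limit_sequentially lim0])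
  finally have "(\<integral>\<^sup>+w. ennreal ((Z w - D w)\<^sup>2) \<partial>M) = 0" by simp
  then have "AE w in M. ennreal ((Z w - D w)\<^sup>2) = 0" by (subst (asm) nn_integral_0_iff_AE) measurable
  then show ?thesis by eventually_elim simp
qed

text \<open>This is boundedness of a continuous map from a compact interval into the square
  integrable functions. Times at which the second moment exceeds \<open>n\<close> would accumulate
  at some \<open>t\<close>, near which the second moment is at most twice the squared distance to
  \<open>D t\<close> plus twice the second moment of \<open>D t\<close>.\<close>

lemma mean_square_continuous_bounded:
  fixes D :: "real \<Rightarrow> 'w \<Rightarrow> real"
  assumes sq: "\<And>t. t \<in> {a..b} \<Longrightarrow> square_integrable M (D t)"
    and cont: "\<And>t. t \<in> {a..b} \<Longrightarrow> ((\<lambda>s. \<integral>w. (D s w - D t w)\<^sup>2 \<partial>M) \<longlongrightarrow> 0) (at t within {a..b})"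
  obtains K where "\<And>t. t \<in> {a..b} \<Longrightarrow> (\<integral>w. (D t w)\<^sup>2 \<partial>M) \<le> K"
proof (rule ccontr)
  assume "\<not> thesis"
  then have "\<exists>t\<in>{a..b}. \<not> (\<integral>w. (D t w)\<^sup>2 \<partial>M) \<le> real n" for n using that by blast
  then obtain T where T: "\<And>n. T n \<in> {a..b}" "\<And>n. real n < (\<integral>w. (D (T n) w)\<^sup>2 \<partial>M)"
    by (metis not_le)
  have "seq_compact {a..b}" by (simp add: compact_imp_seq_compact)
  then have "\<exists>t\<in>{a..b}. \<exists>r. strict_mono r \<and> (T \<circ> r) \<longlonglongrightarrow> t"
    using T(1) unfolding seq_compact_def by simp
  then obtain t r where t: "t \<in> {a..b}" and r: "strict_mono r" "(T \<circ> r) \<longlonglongrightarrow> t"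
    by blast
  let ?d = "\<lambda>s. \<integral>w. (D s w - D t w)\<^sup>2 \<partial>M"
  \<comment> \<open>The limit 0 is also the value \<open>?d t\<close>. Continuity, unlike the
    punctured limit, applies to a subsequence that may hit \<open>t\<close>.\<close>
  have "continuous (at t within {a..b}) ?d" using cont[OF t] by (simp add: continuous_within)
  then have "(\<lambda>n. ?d ((T \<circ> r) n)) \<longlonglongrightarrow> ?d t"
    by (rule continuous_within_tendsto_compose') (simp only: o_apply T(1), rule r(2))
  then have lim: "(\<lambda>n. ?d ((T \<circ> r) n)) \<longlonglongrightarrow> 0" by simp
  have le: "(\<integral>w. (D s w)\<^sup>2 \<partial>M) \<le> 2 * ?d s + 2 * (\<integral>w. (D t w)\<^sup>2 \<partial>M)" if "s \<in> {a..b}" for s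
  proof -
    have int: "integrable M (\<lambda>w. (D s w)\<^sup>2)" "integrable M (\<lambda>w. (D t w)\<^sup>2)"
      "integrable M (\<lambda>w. (D s w - D t w)\<^sup>2)"
      using sq[OF that] sq[OF t] square_integrable_diff[OF sq[OF that] sq[OF t]]
      by (auto simp: square_integrable_def)
    have "x\<^sup>2 \<le> 2 * (x - y)\<^sup>2 + 2 * y\<^sup>2" for x y :: real
      using zero_le_power2[of "x - 2 * y"] by (simp add: power2_diff power2_eq_square algebra_simps)
    then have "(\<integral>w. (D s w)\<^sup>2 \<partial>M) \<le> (\<integral>w. 2 * (D s w - D t w)\<^sup>2 + 2 * (D t w)\<^sup>2 \<partial>M)"
      using int by (intro integral_mono Bochner_Integration.integrable_add integrable_mult_right)
    then show ?thesis using int by simp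
  qed
  have "\<forall>\<^sub>F n in sequentially. ?d ((T \<circ> r) n) < 1" using lim by (rule order_tendstoD) simp
  moreover have "\<forall>\<^sub>F n in sequentially. 2 + 2 * (\<integral>w. (D t w)\<^sup>2 \<partial>M) \<le> real n"
    using filterlim_real_sequentially by (simp add: filterlim_at_top)
  ultimately have "\<forall>\<^sub>F n in sequentially. False"
  proof eventually_elim
    case (elim n)
    have "real n \<le> real (r n)" using seq_suble[OF r(1), of n] by simp
    then show ?case using elim le[OF T(1), of "r n"] T(2)[of "r n"] by simp
  qed
  then show False by simp
qed

section \<open>The joint characteristic function\<close>

lemma joint_char_eq:
  "joint_char M Y Z u v = (\<integral>w. iexp (u * Y w) * iexp (v * Z w) \<partial>M)"
  unfolding joint_char_def by (simp add: exp_add)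

lemma (in finite_measure) integrable_of_square_integrable:
  assumes "square_integrable M Z"
  shows "integrable M Z"
proof -
  have [measurable]: "Z \<in> borel_measurable M" and sq: "integrable M (\<lambda>w. (Z w)\<^sup>2)"
    using assms by (auto simp: square_integrable_def)
  have "\<bar>z\<bar> \<le> 1 + z\<^sup>2" for z :: real
    using zero_le_power2[of "\<bar>z\<bar> - 1"] by (simp add: power2_diff)
  then show ?thesis
    by (intro Bochner_Integration.integrable_bound[OF Bochner_Integration.integrable_add[OF integrable_const sq, of 1]])
      auto
qed

lemma (in prob_space) integrable_iexp_mult:
  assumes [measurable]: "Y \<in> borel_measurable M" and f: "integrable M f"
  shows "integrable M (\<lambda>w. iexp (u * Y w) * (f w :: complex))"
  using f by (intro Bochner_Integration.integrable_bound[OF f]) (auto simp: norm_mult)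

text \<open>The estimate of \<open>iexp x - 1 - \<i> * x\<close> by half the square of
  \<open>x\<close>, applied to \<open>x = (s - v) * Z w\<close> and integrated, bounds the remainder
  by half the second moment of \<open>Z\<close> times the square of \<open>s - v\<close>. Divided by
  the increment it tends to 0.\<close>

lemma (in prob_space) joint_char_has_vector_derivative:
  assumes [measurable]: "Y \<in> borel_measurable M" and Z: "square_integrable M Z"
  shows "(joint_char M Y Z u has_vector_derivative
    (\<integral>w. iexp (u * Y w) * (iexp (v * Z w) * (\<i> * of_real (Z w))) \<partial>M)) (at v)"
proof -
  have [measurable]: "Z \<in> borel_measurable M" and sq: "integrable M (\<lambda>w. (Z w)\<^sup>2)"
    using Z by (auto simp: square_integrable_def)
  have Z_int: "integrable M (\<lambda>w. complex_of_real (Z w))"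
    using integrable_of_square_integrable[OF Z] by simp
  let ?e = "\<lambda>v w. iexp (u * Y w) * iexp (v * Z w)"
  let ?d = "\<lambda>w. iexp (u * Y w) * (iexp (v * Z w) * (\<i> * of_real (Z w)))"
  have e: "integrable M (?e s)" for s
    by (intro integrable_const_bound[where B = 1]) (auto simp: norm_mult)
  have d: "integrable M ?d"
    by (intro integrable_iexp_mult Z_int assms integrable_mult_right)
      (auto simp: norm_mult intro!: Bochner_Integration.integrable_bound[OF Z_int])
  have bound: "norm (joint_char M Y Z u s - joint_char M Y Z u v - (s - v) *\<^sub>R (\<integral>w. ?d w \<partial>M))
      \<le> (\<integral>w. (Z w)\<^sup>2 \<partial>M) / 2 * \<bar>s - v\<bar>\<^sup>2" for s
  proof -
    have eq: "joint_char M Y Z u s - joint_char M Y Z u v - (s - v) *\<^sub>R (\<integral>w. ?d w \<partial>M) =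
        (\<integral>w. ?e s w - ?e v w - (s - v) *\<^sub>R ?d w \<partial>M)"
      unfolding joint_char_eq using e d
      by (simp only: Bochner_Integration.integral_diff Bochner_Integration.integrable_diff
          integral_scaleR_right integrable_scaleR_right)
    have "norm (\<integral>w. ?e s w - ?e v w - (s - v) *\<^sub>R ?d w \<partial>M) \<le> (\<integral>w. (Z w)\<^sup>2 / 2 * \<bar>s - v\<bar>\<^sup>2 \<partial>M)"
    proof (rule order_trans[OF integral_norm_bound integral_mono])
      show "integrable M (\<lambda>w. norm (?e s w - ?e v w - (s - v) *\<^sub>R ?d w))"
        by (intro integrable_norm Bochner_Integration.integrable_diff e integrable_scaleR_right d)
      show "integrable M (\<lambda>w. (Z w)\<^sup>2 / 2 * \<bar>s - v\<bar>\<^sup>2)" using sq by simp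
      fix w
      have "iexp (s * Z w) = iexp (v * Z w) * iexp ((s - v) * Z w)"
        by (simp add: exp_add[symmetric] algebra_simps)
      then have "?e s w - ?e v w - (s - v) *\<^sub>R ?d w =
          ?e v w * (iexp ((s - v) * Z w) - 1 - \<i> * of_real ((s - v) * Z w))"
        by (simp add: scaleR_conv_of_real algebra_simps)
      then have "norm (?e s w - ?e v w - (s - v) *\<^sub>R ?d w) =
          norm (iexp ((s - v) * Z w) - (1 + \<i> * of_real ((s - v) * Z w)))"
        by (simp add: norm_mult diff_diff_eq)
      also have "\<dots> \<le> \<bar>(s - v) * Z w\<bar>\<^sup>2 / 2"
        using iexp_approx1[of "(s - v) * Z w" 1] by (simp add: numeral_2_eq_2)
      finally show "norm (?e s w - ?e v w - (s - v) *\<^sub>R ?d w) \<le> (Z w)\<^sup>2 / 2 * \<bar>s - v\<bar>\<^sup>2"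
        by (simp add: power_mult_distrib mult.commute)
    qed
    also have "\<dots> = (\<integral>w. (Z w)\<^sup>2 \<partial>M) / 2 * \<bar>s - v\<bar>\<^sup>2"
      by (simp only: integral_mult_left_zero integral_divide_zero)
    finally show ?thesis unfolding eq .
  qed
  have "((\<lambda>s. norm (joint_char M Y Z u s - joint_char M Y Z u v - (s - v) *\<^sub>R (\<integral>w. ?d w \<partial>M)) / norm (s - v))
      \<longlongrightarrow> 0) (at v)"
  proof (rule Lim_null_comparison)
    show "\<forall>\<^sub>F s in at v. norm (norm (joint_char M Y Z u s - joint_char M Y Z u v -
        (s - v) *\<^sub>R (\<integral>w. ?d w \<partial>M)) / norm (s - v)) \<le> (\<integral>w. (Z w)\<^sup>2 \<partial>M) / 2 * \<bar>s - v\<bar>"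
      using bound by (intro always_eventually allI)
        (auto simp: divide_le_eq power2_eq_square mult.assoc)
    have "((\<lambda>s. (\<integral>w. (Z w)\<^sup>2 \<partial>M) / 2 * \<bar>s - v\<bar>) \<longlongrightarrow> (\<integral>w. (Z w)\<^sup>2 \<partial>M) / 2 * \<bar>v - v\<bar>) (at v)"
      by (intro tendsto_intros)
    then show "((\<lambda>s. (\<integral>w. (Z w)\<^sup>2 \<partial>M) / 2 * \<bar>s - v\<bar>) \<longlongrightarrow> 0) (at v)" by simp
  qed
  then show ?thesis
    unfolding has_vector_derivative_def has_derivative_iff_norm
    by (auto intro: bounded_linear_scaleR_left)
qed

text \<open>The common core of both inner integrals: \<open>k\<close> is the kernel at a value
  \<open>z\<close> of \<open>Z\<close>, and \<open>K\<close> its integral over (0,A]. The quadratic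
  bound \<open>k_le\<close> serves Fubini on (0,A] times the probability space, through the second
  moment of \<open>Z\<close>. The linear bound \<open>K_le\<close>, uniform in \<open>A\<close>,
  serves dominated convergence as \<open>A\<close> tends to infinity.\<close>

lemma (in prob_space) improper_integral_expectation:
  fixes k K :: "real \<Rightarrow> real \<Rightarrow> real"
  assumes [measurable]: "Y \<in> borel_measurable M" and Z: "square_integrable M Z"
    and k[measurable]: "(\<lambda>(v, z). k v z) \<in> borel_measurable (borel \<Otimes>\<^sub>M borel)"
    and k_le: "\<And>v z. 0 < v \<Longrightarrow> \<bar>k v z\<bar> \<le> C * z\<^sup>2"
    and K: "\<And>A z. 0 < A \<Longrightarrow> (LINT v:{0<..A}|lborel. k v z) = K A z"
    and K_le: "\<And>A z. 0 < A \<Longrightarrow> \<bar>K A z\<bar> \<le> B * \<bar>z\<bar>"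
    and K_lim: "\<And>z. ((\<lambda>A. K A z) \<longlongrightarrow> c * \<bar>z\<bar>) at_top"
    and f: "\<And>v. 0 < v \<Longrightarrow> f v = (\<integral>w. iexp (u * Y w) * of_real (k v (Z w)) \<partial>M)"
  shows "improper_integrable f"
    and "improper_integral f = of_real c * (\<integral>w. iexp (u * Y w) * of_real \<bar>Z w\<bar> \<partial>M)"
proof -
  have [measurable]: "Z \<in> borel_measurable M" and sq: "integrable M (\<lambda>w. (Z w)\<^sup>2)"
    using Z by (auto simp: square_integrable_def)
  have Z_int: "integrable M Z" using integrable_of_square_integrable[OF Z] .
  interpret L: pair_sigma_finite lborel M ..
  let ?h = "\<lambda>A v w. indicator {0<..A} v *\<^sub>R (iexp (u * Y w) * of_real (k v (Z w)))"
  have int: "integrable (lborel \<Otimes>\<^sub>M M) (\<lambda>(v, w). ?h A v w)" for A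
  proof (rule Bochner_Integration.integrable_bound)
    show "integrable (lborel \<Otimes>\<^sub>M M) (\<lambda>(v, w). indicator {0<..A} v *\<^sub>R (C * (Z w)\<^sup>2))"
    proof (rule L.Fubini_integrable)
      have "integrable lborel (\<lambda>v. indicator {0<..A} v *\<^sub>R (\<integral>w. \<bar>C * (Z w)\<^sup>2\<bar> \<partial>M))"
        by (cases "0 \<le> A") (auto intro!: integrable_real_indicator)
      then show "integrable lborel (\<lambda>v. \<integral>w. norm (case (v, w) of (v, w) \<Rightarrow>
          indicator {0<..A} v *\<^sub>R (C * (Z w)\<^sup>2)) \<partial>M)"
        by (simp add: abs_mult)
    qed (use sq in auto)
    show "AE x in lborel \<Otimes>\<^sub>M M. norm (case x of (v, w) \<Rightarrow> ?h A v w) \<le>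
        norm (case x of (v, w) \<Rightarrow> indicator {0<..A} v *\<^sub>R (C * (Z w)\<^sup>2))"
      using k_le by (intro AE_I2) (auto simp: norm_mult indicator_def intro: order_trans[OF k_le abs_ge_self])
  qed measurable
  have f_eq: "indicator {0<..A} v *\<^sub>R f v = (\<integral>w. ?h A v w \<partial>M)" for A v
    using f[of v] by (simp add: indicator_def)
  have f_int: "set_integrable lborel {0<..A} f" for A
    unfolding set_integrable_def f_eq using L.integrable_fst[OF int] .
  have f_val: "(LINT v:{0<..A}|lborel. f v) = (\<integral>w. iexp (u * Y w) * of_real (K A (Z w)) \<partial>M)"
    if "0 < A" for A
  proof -
    have "(\<integral>v. ?h A v w \<partial>lborel) = iexp (u * Y w) * of_real (K A (Z w))" for w
    proof -
      have "(\<integral>v. ?h A v w \<partial>lborel) =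
          (\<integral>v. iexp (u * Y w) * of_real (indicator {0<..A} v *\<^sub>R k v (Z w)) \<partial>lborel)"
        by (intro Bochner_Integration.integral_cong) (auto simp: indicator_def)
      also have "\<dots> = iexp (u * Y w) * of_real (\<integral>v. indicator {0<..A} v *\<^sub>R k v (Z w) \<partial>lborel)"
        by (simp only: integral_mult_right_zero integral_complex_of_real)
      finally show ?thesis using K[OF that] by (simp add: set_lebesgue_integral_def)
    qed
    then show ?thesis
      unfolding set_lebesgue_integral_def f_eq using L.Fubini_integral[OF int, of A] by simp
  qed
  have [measurable]: "K A \<in> borel_measurable borel" if "0 < A" for A
    unfolding K[OF that, symmetric] set_lebesgue_integral_def by measurable
  \<comment> \<open>The indicator in \<open>A\<close> sets the integrand to 0 for nonpositive
    \<open>A\<close>: dominated convergence asks for measurability at every \<open>A\<close>, while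
    \<open>K A\<close> is identified with an integral only for \<open>0 < A\<close>.\<close>
  have "((\<lambda>A. \<integral>w. indicator {0<..} A *\<^sub>R (iexp (u * Y w) * of_real (K A (Z w))) \<partial>M) \<longlongrightarrow>
      (\<integral>w. iexp (u * Y w) * of_real (c * \<bar>Z w\<bar>) \<partial>M)) at_top"
  proof (rule integral_dominated_convergence_at_top)
    show "\<forall>\<^sub>F A in at_top. AE w in M.
        norm (indicator {0<..} A *\<^sub>R (iexp (u * Y w) * complex_of_real (K A (Z w)))) \<le> B * \<bar>Z w\<bar>"
      using eventually_gt_at_top[of 0] by eventually_elim (use K_le in \<open>auto simp: norm_mult\<close>)
    show "AE w in M. ((\<lambda>A. indicator {0<..} A *\<^sub>R (iexp (u * Y w) * of_real (K A (Z w)))) \<longlongrightarrow>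
        iexp (u * Y w) * of_real (c * \<bar>Z w\<bar>)) at_top"
    proof (intro AE_I2)
      fix w
      have "((\<lambda>A. iexp (u * Y w) * of_real (K A (Z w))) \<longlongrightarrow> iexp (u * Y w) * of_real (c * \<bar>Z w\<bar>)) at_top"
        by (intro tendsto_intros K_lim)
      then show "((\<lambda>A. indicator {0<..} A *\<^sub>R (iexp (u * Y w) * of_real (K A (Z w)))) \<longlongrightarrow>
          iexp (u * Y w) * of_real (c * \<bar>Z w\<bar>)) at_top"
        by (rule Lim_transform_eventually)
          (use eventually_gt_at_top[of 0] in \<open>eventually_elim, simp\<close>)
    qed
    show "(\<lambda>w. indicator {0<..} A *\<^sub>R (iexp (u * Y w) * complex_of_real (K A (Z w)))) \<in> borel_measurable M" for A :: real
      by (cases "0 < A") auto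
  qed (use Z_int in auto)
  then have "((\<lambda>A. LINT v:{0<..A}|lborel. f v) \<longlongrightarrow>
      (\<integral>w. iexp (u * Y w) * of_real (c * \<bar>Z w\<bar>) \<partial>M)) at_top"
    by (rule Lim_transform_eventually)
      (use eventually_gt_at_top[of 0] in \<open>eventually_elim, simp add: f_val\<close>)
  moreover have "(\<integral>w. iexp (u * Y w) * of_real (c * \<bar>Z w\<bar>) \<partial>M) =
      of_real c * (\<integral>w. iexp (u * Y w) * of_real \<bar>Z w\<bar> \<partial>M)"
    by (subst integral_mult_right_zero[symmetric]) (simp add: mult_ac)
  ultimately have lim: "((\<lambda>A. LINT v:{0<..A}|lborel. f v) \<longlongrightarrow>
      of_real c * (\<integral>w. iexp (u * Y w) * of_real \<bar>Z w\<bar> \<partial>M)) at_top" by simp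
  show "improper_integrable f" unfolding improper_integrable_def using f_int lim by blast
  show "improper_integral f = of_real c * (\<integral>w. iexp (u * Y w) * of_real \<bar>Z w\<bar> \<partial>M)"
    unfolding improper_integral_def by (rule tendsto_Lim[OF _ lim]) simp
qed

section \<open>Sine and cosine kernels and their antiderivatives\<close>

text \<open>The kernels are quotients that degenerate at \<open>v = 0\<close>, so the antiderivative
  is differentiated only in the interior and merely continuous at the ends. The fundamental theorem
  then gives a gauge integral, and the bound on \<open>k\<close> makes it a Lebesgue
  integral.\<close>

lemma set_integral_Ioc_eq_diff:
  fixes P k :: "real \<Rightarrow> real"
  assumes "0 < A" and P: "continuous_on {0..A} P"
    and der: "\<And>v. 0 < v \<Longrightarrow> v < A \<Longrightarrow> (P has_real_derivative k v) (at v)"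
    and k[measurable]: "k \<in> borel_measurable borel" and k_le: "\<And>v. 0 < v \<Longrightarrow> \<bar>k v\<bar> \<le> C"
  shows "(LINT v:{0<..A}|lborel. k v) = P A - P 0"
proof -
  have "(k has_integral (P A - P 0)) {0..A}"
    using assms(1) P der
    by (intro fundamental_theorem_of_calculus_interior)
      (auto simp: has_real_derivative_iff_has_vector_derivative)
  then have "(k has_integral (P A - P 0)) {0<..A}"
    by (subst has_integral_spike_set_eq[where T = "{0..A}"]) (auto intro: negligible_subset[of "{0}"])
  moreover have "set_integrable lborel {0<..A} k"
    unfolding set_integrable_def
  proof (rule Bochner_Integration.integrable_bound)
    show "integrable lborel (\<lambda>v. indicator {0<..A} v *\<^sub>R C)"
      using assms(1) by (auto intro!: integrable_real_indicator)
    show "AE v in lborel. norm (indicator {0<..A} v *\<^sub>R k v) \<le> norm (indicator {0<..A} v *\<^sub>R C)"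
      using k_le by (intro AE_I2) (auto simp: indicator_def intro: order_trans[OF k_le abs_ge_self])
  qed measurable
  ultimately show ?thesis by (simp add: set_borel_integral_eq_integral integral_unique)
qed

lemma DERIV_Si_mult:
  assumes "v \<noteq> 0"
  shows "((\<lambda>v. z * Si (v * z)) has_real_derivative z * sin (v * z) / v) (at v)"
proof -
  have "((\<lambda>v. z * Si (v * z)) has_real_derivative z * (sinc (v * z) * z)) (at v)"
    by (auto intro!: derivative_eq_intros DERIV_chain2[OF DERIV_Si])
  then show ?thesis using assms by (cases "z = 0") auto
qed

lemma continuous_on_Si_mult: "continuous_on S (\<lambda>v. z * Si (v * z))"
proof -
  have "continuous_on UNIV Si" by (intro continuous_at_imp_continuous_on ballI isCont_Si)
  then have "continuous_on S (\<lambda>v. Si (v * z))"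
    by (rule continuous_on_compose2) (auto intro!: continuous_intros)
  then show ?thesis by (intro continuous_on_mult continuous_on_const)
qed

lemma Si_zero: "Si 0 = 0"
  using Si_neg[of 0] by simp

text \<open>This is the origin of the absolute value and of \<open>pi\<close>: \<open>Si\<close> is
  odd, so for positive \<open>A\<close> the product depends only on \<open>\<bar>z\<bar>\<close>,
  and \<open>Si\<close> tends to \<open>pi / 2\<close>.\<close>

lemma Si_mult_tendsto: "((\<lambda>A. z * Si (A * z)) \<longlongrightarrow> pi / 2 * \<bar>z\<bar>) at_top"
proof (cases "z = 0")
  case False
  have "((\<lambda>A. \<bar>z\<bar> * Si (A * \<bar>z\<bar>)) \<longlongrightarrow> \<bar>z\<bar> * (pi / 2)) at_top"
    using False by (intro tendsto_mult tendsto_const filterlim_compose[OF Si_at_top]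
        filterlim_at_top_mult_tendsto_pos[OF tendsto_const _ filterlim_ident] ) auto
  moreover have "\<forall>\<^sub>F A in at_top. \<bar>z\<bar> * Si (A * \<bar>z\<bar>) = z * Si (A * z)"
    using eventually_gt_at_top[of 0]
  proof eventually_elim
    case (elim A)
    then have "0 \<le> A * \<bar>z\<bar>" by simp
    from Si_neg[OF this] show ?case by (cases "0 \<le> z") auto
  qed
  ultimately show ?thesis by (auto intro: Lim_transform_eventually simp: mult.commute)
qed simp

text \<open>Both follow from \<open>1 - cos x = 2 * (sin (x / 2))\<^sup>2\<close>. The quadratic
  bound tames the cosine kernel near 0; the linear one bounds its boundary term by
  \<open>\<bar>z\<bar>\<close> uniformly in \<open>A\<close>.\<close>

lemma abs_cos_minus_one_le: "\<bar>cos x - 1\<bar> \<le> \<bar>x\<bar>" "\<bar>cos x - 1\<bar> \<le> x\<^sup>2 / 2" for x :: real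
proof -
  have eq: "\<bar>cos x - 1\<bar> = 2 * (sin (x / 2))\<^sup>2"
    using cos_double_sin[of "x / 2"] by simp
  have le: "\<bar>sin (x / 2)\<bar> \<le> \<bar>x / 2\<bar>" by (rule abs_sin_x_le_abs_x)
  have "\<bar>sin (x / 2)\<bar> * \<bar>sin (x / 2)\<bar> \<le> \<bar>x / 2\<bar> * 1" using le by (intro mult_mono) auto
  then show "\<bar>cos x - 1\<bar> \<le> \<bar>x\<bar>" unfolding eq by (simp add: power2_eq_square)
  have "(sin (x / 2))\<^sup>2 \<le> (x / 2)\<^sup>2" using le by (rule abs_le_square_iff[THEN iffD1])
  then show "\<bar>cos x - 1\<bar> \<le> x\<^sup>2 / 2" unfolding eq by (simp add: power_divide)
qed

text \<open>The kernel is \<open>\<i> * z * (iexp (v * z) - iexp (- v * z)) / v\<close>, the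
  contribution of the value \<open>z\<close> to the difference of derivatives in the first
  formula.\<close>

lemma set_integral_sin_kernel:
  assumes "0 < A"
  shows "(LINT v:{0<..A}|lborel. - 2 * (z * sin (v * z) / v)) = - 2 * (z * Si (A * z))"
proof -
  have "\<bar>- 2 * (z * sin (v * z) / v)\<bar> \<le> 2 * z\<^sup>2" if "0 < v" for v
  proof -
    have "\<bar>z\<bar> * \<bar>sin (v * z)\<bar> \<le> \<bar>z\<bar> * \<bar>v * z\<bar>"
      by (intro mult_left_mono abs_sin_x_le_abs_x) auto
    then show ?thesis using that by (simp add: abs_mult divide_le_eq power2_eq_square mult_ac)
  qed
  then have "(LINT v:{0<..A}|lborel. - 2 * (z * sin (v * z) / v)) =
      - 2 * (z * Si (A * z)) - - 2 * (z * Si (0 * z))"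
    by (intro set_integral_Ioc_eq_diff[OF assms] continuous_on_mult continuous_on_const
        continuous_on_Si_mult DERIV_cmult DERIV_Si_mult) auto
  then show ?thesis by (simp add: Si_zero)
qed

text \<open>The kernel is \<open>(iexp (v * z) + iexp (- v * z) - 2) / v\<^sup>2\<close>.
  Integration by parts reduces it to the sine kernel, at the cost of the boundary term with
  denominator \<open>A\<close>.\<close>

lemma set_integral_cos_kernel:
  assumes "0 < A"
  shows "(LINT v:{0<..A}|lborel. 2 * ((cos (v * z) - 1) / v\<^sup>2)) =
    2 * (- ((cos (A * z) - 1) / A) - z * Si (A * z))"
proof -
  have le: "\<bar>2 * ((cos (v * z) - 1) / v\<^sup>2)\<bar> \<le> z\<^sup>2" if "0 < v" for v
    using abs_cos_minus_one_le(2)[of "v * z"] that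
    by (simp add: abs_mult divide_le_eq power_mult_distrib mult_ac)
  have der: "((\<lambda>v. 2 * (- ((cos (v * z) - 1) / v) - z * Si (v * z))) has_real_derivative
      2 * ((cos (v * z) - 1) / v\<^sup>2)) (at v)" if "0 < v" for v
  proof -
    have "((\<lambda>v. - ((cos (v * z) - 1) / v)) has_real_derivative
        z * sin (v * z) / v + (cos (v * z) - 1) / v\<^sup>2) (at v)"
      using that by (auto intro!: derivative_eq_intros simp: field_simps power2_eq_square)
    from DERIV_cmult[OF DERIV_diff[OF this DERIV_Si_mult], of 2 z] that show ?thesis by simp
  qed
  \<comment> \<open>Division by zero gives 0 at \<open>v = 0\<close>, which is also the limit there,
    so the quotient is continuous as it stands.\<close>
  have cont: "continuous_on {0..A} (\<lambda>v. (cos (v * z) - 1) / v)"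
  proof (rule continuous_at_imp_continuous_on, intro ballI)
    fix v assume "v \<in> {0..A}"
    show "isCont (\<lambda>v. (cos (v * z) - 1) / v) v"
    proof (cases "v = 0")
      case True
      have "((\<lambda>v. (cos (v * z) - 1) / v) \<longlongrightarrow> 0) (at 0)"
      proof (rule Lim_null_comparison)
        show "\<forall>\<^sub>F v in at 0. norm ((cos (v * z) - 1) / v) \<le> z\<^sup>2 / 2 * \<bar>v\<bar>"
        proof (intro always_eventually allI)
          fix v show "norm ((cos (v * z) - 1) / v) \<le> z\<^sup>2 / 2 * \<bar>v\<bar>"
            using abs_cos_minus_one_le(2)[of "v * z"]
            by (cases "v = 0") (auto simp: divide_le_eq power2_eq_square abs_mult mult_ac)
        qed
        have "((\<lambda>v. z\<^sup>2 / 2 * \<bar>v\<bar>) \<longlongrightarrow> z\<^sup>2 / 2 * \<bar>0\<bar>) (at 0)" by (intro tendsto_intros)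
        then show "((\<lambda>v. z\<^sup>2 / 2 * \<bar>v\<bar>) \<longlongrightarrow> 0) (at 0)" by simp
      qed
      then show ?thesis using True by (simp add: isCont_def)
    qed (intro continuous_intros)
  qed
  have "(LINT v:{0<..A}|lborel. 2 * ((cos (v * z) - 1) / v\<^sup>2)) =
      2 * (- ((cos (A * z) - 1) / A) - z * Si (A * z)) - 2 * (- ((cos (0 * z) - 1) / 0) - z * Si (0 * z))"
  proof (rule set_integral_Ioc_eq_diff[OF assms _ der _ le])
    show "continuous_on {0..A} (\<lambda>v. 2 * (- ((cos (v * z) - 1) / v) - z * Si (v * z)))"
      by (intro continuous_on_mult[OF continuous_on_const] continuous_on_diff continuous_on_minus
          cont continuous_on_Si_mult)
  qed measurable
  then show ?thesis by (simp add: Si_zero)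
qed

section \<open>Inner integrals of the joint characteristic function\<close>

context prob_space
begin

text \<open>The factor \<open>- pi\<close> is the \<open>- 2\<close> of the sine kernel times the
  limit \<open>pi / 2\<close> of \<open>Si\<close>.\<close>

lemma
  fixes u :: real
  assumes Y[measurable]: "Y \<in> borel_measurable M" and Z: "square_integrable M Z"
  defines "I \<equiv> \<lambda>v. of_real (1 / v) * (joint_char_dv M Y Z u v - joint_char_dv M Y Z u (- v))"
  shows improper_integrable_joint_char_dv: "improper_integrable I"
    and improper_integral_joint_char_dv:
      "improper_integral I = - of_real pi * (\<integral>w. iexp (u * Y w) * of_real \<bar>Z w\<bar> \<partial>M)"
proof -
  have [measurable]: "Z \<in> borel_measurable M" using Z by (auto simp: square_integrable_def)
  have Z_int: "integrable M Z" using integrable_of_square_integrable[OF Z] .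
  obtain B where B: "\<And>x. \<bar>Si x\<bar> \<le> B" using bounded_Si by blast
  have dv: "joint_char_dv M Y Z u v =
      (\<integral>w. iexp (u * Y w) * (iexp (v * Z w) * (\<i> * of_real (Z w))) \<partial>M)" for v
    unfolding joint_char_dv_def
    by (rule vector_derivative_at[OF joint_char_has_vector_derivative[OF Y Z]])
  have int: "integrable M (\<lambda>w. iexp (u * Y w) * (iexp (v * Z w) * (\<i> * of_real (Z w))))" for v
    using Z_int by (intro Bochner_Integration.integrable_bound[OF Z_int]) (auto simp: norm_mult)
  have I: "I v = (\<integral>w. iexp (u * Y w) * of_real (- 2 * (Z w * sin (v * Z w) / v)) \<partial>M)" for v
  proof -
    have "I v = (\<integral>w. of_real (1 / v) * (iexp (u * Y w) * (iexp (v * Z w) * (\<i> * of_real (Z w))) -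
        iexp (u * Y w) * (iexp (- v * Z w) * (\<i> * of_real (Z w)))) \<partial>M)"
      unfolding I_def dv by (simp only: integral_mult_right_zero Bochner_Integration.integral_diff[OF int int])
    also have "\<dots> = (\<integral>w. iexp (u * Y w) * of_real (- 2 * (Z w * sin (v * Z w) / v)) \<partial>M)"
    proof (rule Bochner_Integration.integral_cong[OF refl])
      fix w
      have "iexp (v * Z w) - iexp (- v * Z w) = 2 * \<i> * of_real (sin (v * Z w))"
        by (simp add: complex_eq_iff Re_exp Im_exp)
      then have "iexp (v * Z w) = iexp (- v * Z w) + 2 * \<i> * of_real (sin (v * Z w))"
        by (simp add: algebra_simps)
      then show "of_real (1 / v) * (iexp (u * Y w) * (iexp (v * Z w) * (\<i> * of_real (Z w))) -
          iexp (u * Y w) * (iexp (- v * Z w) * (\<i> * of_real (Z w)))) =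
          iexp (u * Y w) * of_real (- 2 * (Z w * sin (v * Z w) / v))"
        by (simp only: distrib_right distrib_left) (simp add: field_simps)
    qed
    finally show ?thesis .
  qed
  have le: "\<bar>- 2 * (z * sin (v * z) / v)\<bar> \<le> 2 * z\<^sup>2" if "0 < v" for v z :: real
  proof -
    have "\<bar>z\<bar> * \<bar>sin (v * z)\<bar> \<le> \<bar>z\<bar> * \<bar>v * z\<bar>"
      by (intro mult_left_mono abs_sin_x_le_abs_x) auto
    then show ?thesis using that by (simp add: abs_mult divide_le_eq power2_eq_square mult_ac)
  qed
  have K_le: "\<bar>- 2 * (z * Si (A * z))\<bar> \<le> 2 * B * \<bar>z\<bar>" for A z
    using mult_right_mono[OF B[of "A * z"], of "\<bar>z\<bar>"] by (simp add: abs_mult mult_ac)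
  have K_lim: "((\<lambda>A. - 2 * (z * Si (A * z))) \<longlongrightarrow> - pi * \<bar>z\<bar>) at_top" for z
    using tendsto_mult_left[OF Si_mult_tendsto[of z], of "- 2"] by simp
  note * = improper_integral_expectation[of Y Z "\<lambda>v z. - 2 * (z * sin (v * z) / v)" 2
      "\<lambda>A z. - 2 * (z * Si (A * z))" "2 * B" "- pi" I u, OF Y Z _ le set_integral_sin_kernel K_le K_lim I]
  show "improper_integrable I" by (rule *(1)) measurable
  have "improper_integral I = of_real (- pi) * (\<integral>w. iexp (u * Y w) * of_real \<bar>Z w\<bar> \<partial>M)"
    by (rule *(2)) measurable
  then show "improper_integral I = - of_real pi * (\<integral>w. iexp (u * Y w) * of_real \<bar>Z w\<bar> \<partial>M)" by simp
qed

lemma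
  fixes u :: real
  assumes Y[measurable]: "Y \<in> borel_measurable M" and Z: "square_integrable M Z"
  defines "I \<equiv> \<lambda>v. of_real (1 / v\<^sup>2) *
    (joint_char M Y Z u v + joint_char M Y Z u (- v) - 2 * joint_char M Y Z u 0)"
  shows improper_integrable_joint_char: "improper_integrable I"
    and improper_integral_joint_char:
      "improper_integral I = - of_real pi * (\<integral>w. iexp (u * Y w) * of_real \<bar>Z w\<bar> \<partial>M)"
proof -
  have [measurable]: "Z \<in> borel_measurable M" using Z by (auto simp: square_integrable_def)
  obtain B where B: "\<And>x. \<bar>Si x\<bar> \<le> B" using bounded_Si by blast
  have int: "integrable M (\<lambda>w. iexp (u * Y w) * iexp (v * Z w))" for v
    by (intro integrable_const_bound[where B = 1]) (auto simp: norm_mult)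
  have I: "I v = (\<integral>w. iexp (u * Y w) * of_real (2 * ((cos (v * Z w) - 1) / v\<^sup>2)) \<partial>M)" for v
  proof -
    have "I v = (\<integral>w. of_real (1 / v\<^sup>2) * (iexp (u * Y w) * iexp (v * Z w) +
        iexp (u * Y w) * iexp (- v * Z w) - 2 * (iexp (u * Y w) * iexp (0 * Z w))) \<partial>M)"
      unfolding I_def joint_char_eq
      by (simp only: integral_mult_right_zero Bochner_Integration.integral_diff
          Bochner_Integration.integral_add Bochner_Integration.integrable_add int integrable_mult_right)
    also have "\<dots> = (\<integral>w. iexp (u * Y w) * of_real (2 * ((cos (v * Z w) - 1) / v\<^sup>2)) \<partial>M)"
    proof (rule Bochner_Integration.integral_cong[OF refl])
      fix w
      have cos: "iexp (v * Z w) + iexp (- v * Z w) = 2 * of_real (cos (v * Z w))"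
        by (simp add: complex_eq_iff Re_exp Im_exp)
      \<comment> \<open>Only the sum of the two exponentials enters, so the identity is proved with
        them as free variables \<open>p\<close> and \<open>q\<close>.\<close>
      have alg: "x * (e * p + e * q - 2 * (e * iexp (0 * Z w))) = e * (2 * (x * (c - 1)))"
        if "p + q = 2 * c" for x e p q c :: complex
      proof -
        have "x * (e * p + e * q - 2 * (e * iexp (0 * Z w))) = x * (e * ((p + q) - 2))"
          by (simp add: algebra_simps)
        then show ?thesis unfolding that by (simp add: algebra_simps)
      qed
      show "of_real (1 / v\<^sup>2) * (iexp (u * Y w) * iexp (v * Z w) +
          iexp (u * Y w) * iexp (- v * Z w) - 2 * (iexp (u * Y w) * iexp (0 * Z w))) =
          iexp (u * Y w) * of_real (2 * ((cos (v * Z w) - 1) / v\<^sup>2))"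
        using alg[OF cos, of "of_real (1 / v\<^sup>2)" "iexp (u * Y w)"] by simp
    qed
    finally show ?thesis .
  qed
  have le: "\<bar>2 * ((cos (v * z) - 1) / v\<^sup>2)\<bar> \<le> 1 * z\<^sup>2" if "0 < v" for v z :: real
    using abs_cos_minus_one_le(2)[of "v * z"] that
    by (simp add: abs_mult divide_le_eq power_mult_distrib mult_ac)
  \<comment> \<open>Both contributions are doubled: \<open>B\<close> bounds \<open>Si\<close>, and 1
    comes from the boundary term.\<close>
  have K_le: "\<bar>2 * (- ((cos (A * z) - 1) / A) - z * Si (A * z))\<bar> \<le> (2 * B + 2) * \<bar>z\<bar>" if "0 < A" for A z
  proof -
    have "\<bar>(cos (A * z) - 1) / A\<bar> \<le> \<bar>z\<bar>"
      using abs_cos_minus_one_le(1)[of "A * z"] that by (simp add: abs_mult divide_le_eq mult_ac)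
    moreover have "\<bar>z * Si (A * z)\<bar> \<le> B * \<bar>z\<bar>"
      using mult_right_mono[OF B[of "A * z"], of "\<bar>z\<bar>"] by (simp add: abs_mult mult_ac)
    moreover have "\<bar>2 * (- x - y)\<bar> \<le> (2 * B + 2) * r" if "\<bar>x\<bar> \<le> r" "\<bar>y\<bar> \<le> B * r" for x y r
      using that by (simp add: distrib_right)
    ultimately show ?thesis by blast
  qed
  have K_lim: "((\<lambda>A. 2 * (- ((cos (A * z) - 1) / A) - z * Si (A * z))) \<longlongrightarrow> - pi * \<bar>z\<bar>) at_top" for z
  proof -
    have "((\<lambda>A. (cos (A * z) - 1) / A) \<longlongrightarrow> 0) at_top"
    proof (rule Lim_null_comparison)
      show "\<forall>\<^sub>F A in at_top. norm ((cos (A * z) - 1) / A) \<le> 2 / A"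
        using eventually_gt_at_top[of 0]
      proof eventually_elim
        case (elim A)
        have "\<bar>cos (A * z) - 1\<bar> \<le> 2" using cos_le_one[of "A * z"] cos_ge_minus_one[of "A * z"] by linarith
        then show ?case using elim by (simp add: divide_right_mono)
      qed
      show "((\<lambda>A::real. 2 / A) \<longlongrightarrow> 0) at_top"
        by (intro tendsto_divide_0[OF tendsto_const] filterlim_at_top_imp_at_infinity filterlim_ident)
    qed
    then have "((\<lambda>A. 2 * (- ((cos (A * z) - 1) / A) - z * Si (A * z))) \<longlongrightarrow> 2 * (- 0 - pi / 2 * \<bar>z\<bar>)) at_top"
      by (intro tendsto_intros Si_mult_tendsto)
    then show ?thesis by simp
  qed
  note * = improper_integral_expectation[of Y Z "\<lambda>v z. 2 * ((cos (v * z) - 1) / v\<^sup>2)" 1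
      "\<lambda>A z. 2 * (- ((cos (A * z) - 1) / A) - z * Si (A * z))" "2 * B + 2" "- pi" I u,
      OF Y Z _ le set_integral_cos_kernel K_le K_lim I]
  show "improper_integrable I" by (rule *(1)) measurable
  have "improper_integral I = of_real (- pi) * (\<integral>w. iexp (u * Y w) * of_real \<bar>Z w\<bar> \<partial>M)"
    by (rule *(2)) measurable
  then show "improper_integral I = - of_real pi * (\<integral>w. iexp (u * Y w) * of_real \<bar>Z w\<bar> \<partial>M)" by simp
qed

end

section \<open>Mean number of crossings\<close>

context prob_space
begin

text \<open>An idealised setting: paths are regular for every outcome and continuous on the whole
  line, and the derivative enters only through a bound on its first absolute moment that is uniform
  in time.\<close>

context
  fixes Y Z :: "real \<Rightarrow> 'a \<Rightarrow> real" and a b K :: real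
  assumes ab: "a < b"
    and Y_meas[measurable]: "\<And>t. Y t \<in> borel_measurable M"
    and Z_meas[measurable]: "\<And>t. Z t \<in> borel_measurable M"
    and Y_cont: "\<And>w. w \<in> space M \<Longrightarrow> continuous_on UNIV (\<lambda>t. Y t w)"
    and Z_cont: "\<And>w. w \<in> space M \<Longrightarrow> continuous_on UNIV (\<lambda>t. Z t w)"
    and der: "\<And>w t. w \<in> space M \<Longrightarrow> t \<in> {a..b} \<Longrightarrow>
      ((\<lambda>s. Y s w) has_real_derivative Z t w) (at t within {a..b})"
    and Z_le: "\<And>t. t \<in> {a..b} \<Longrightarrow> (\<integral>\<^sup>+w. ennreal \<bar>Z t w\<bar> \<partial>M) \<le> ennreal K"
begin

interpretation L: pair_sigma_finite lborel M ..

lemma Y_joint[measurable]: "(\<lambda>(t, w). Y t w) \<in> borel_measurable (borel \<Otimes>\<^sub>M M)"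
  by (rule borel_measurable_continuous_paths[OF Y_meas Y_cont])

lemma Z_joint[measurable]: "(\<lambda>(t, w). Z t w) \<in> borel_measurable (borel \<Otimes>\<^sub>M M)"
  by (rule borel_measurable_continuous_paths[OF Z_meas Z_cont])

lemma crossings_joint[measurable]: "(\<lambda>(y, w). crossings Y a b y w) \<in> borel_measurable (borel \<Otimes>\<^sub>M M)"
  by (rule borel_measurable_crossings[OF ab Y_meas Y_cont])

lemma borel_measurable_mean_crossings: "mean_crossings M Y a b \<in> borel_measurable borel"
  unfolding mean_crossings_def[abs_def] by measurable

text \<open>Tonelli brings the level integral inside, the indicatrix formula turns it into a time
  integral of \<open>\<bar>Z t w\<bar>\<close>, and a second exchange leaves at most
  \<open>K * (b - a)\<close>.\<close>

lemma nn_integral_crossings_finite: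
  "(\<integral>\<^sup>+x. (case x of (y, w) \<Rightarrow> crossings Y a b y w) \<partial>(lborel \<Otimes>\<^sub>M M)) < \<infinity>"
proof -
  have "(\<integral>\<^sup>+x. (case x of (y, w) \<Rightarrow> crossings Y a b y w) \<partial>(lborel \<Otimes>\<^sub>M M)) =
      (\<integral>\<^sup>+w. (\<integral>\<^sup>+y. crossings Y a b y w \<partial>lborel) \<partial>M)"
    by (subst L.nn_integral_snd[symmetric]) auto
  also have "\<dots> = (\<integral>\<^sup>+w. (\<integral>\<^sup>+t. ennreal \<bar>Z t w\<bar> * indicator {a..b} t \<partial>lborel) \<partial>M)"
  proof (rule nn_integral_cong)
    fix w assume w: "w \<in> space M"
    show "(\<integral>\<^sup>+y. crossings Y a b y w \<partial>lborel) = (\<integral>\<^sup>+t. ennreal \<bar>Z t w\<bar> * indicator {a..b} t \<partial>lborel)"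
      unfolding crossings_def
      using nn_integral_level_count[OF ab der[OF w] continuous_on_subset[OF Z_cont[OF w] subset_UNIV]] .
  qed
  also have "\<dots> = (\<integral>\<^sup>+t. (\<integral>\<^sup>+w. ennreal \<bar>Z t w\<bar> * indicator {a..b} t \<partial>M) \<partial>lborel)"
    by (rule L.Fubini') measurable
  also have "\<dots> \<le> (\<integral>\<^sup>+t. ennreal K * indicator {a..b} t \<partial>lborel)"
    using Z_le by (intro nn_integral_mono) (auto simp: indicator_def)
  also have "\<dots> < \<infinity>"
    using ab by (simp add: nn_integral_cmult ennreal_mult_less_top)
  finally show ?thesis .
qed

lemma nn_integral_mean_crossings_finite: "(\<integral>\<^sup>+y. mean_crossings M Y a b y \<partial>lborel) < \<infinity>"
  using nn_integral_crossings_finite unfolding mean_crossings_def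
  by (subst (asm) nn_integral_fst[symmetric]) auto

lemma integrable_path_derivative:
  "integrable (lborel \<Otimes>\<^sub>M M) (\<lambda>(t, w). indicator {a..b} t *\<^sub>R (of_real \<bar>Z t w\<bar> * iexp (u * Y t w)))"
proof (rule integrableI_bounded)
  have "(\<integral>\<^sup>+x. ennreal (norm (case x of (t, w) \<Rightarrow>
        indicator {a..b} t *\<^sub>R (complex_of_real \<bar>Z t w\<bar> * iexp (u * Y t w)))) \<partial>(lborel \<Otimes>\<^sub>M M)) =
      (\<integral>\<^sup>+x. (case x of (t, w) \<Rightarrow> ennreal \<bar>Z t w\<bar> * indicator {a..b} t) \<partial>(lborel \<Otimes>\<^sub>M M))"
    by (intro nn_integral_cong) (auto simp: norm_mult indicator_def)
  also have "\<dots> = (\<integral>\<^sup>+t. (\<integral>\<^sup>+w. ennreal \<bar>Z t w\<bar> * indicator {a..b} t \<partial>M) \<partial>lborel)"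
    by (subst nn_integral_fst[symmetric]) auto
  also have "\<dots> \<le> (\<integral>\<^sup>+t. ennreal K * indicator {a..b} t \<partial>lborel)"
    using Z_le by (intro nn_integral_mono) (auto simp: indicator_def)
  also have "\<dots> < \<infinity>"
    using ab by (simp add: nn_integral_cmult ennreal_mult_less_top)
  finally show "(\<integral>\<^sup>+x. ennreal (norm (case x of (t, w) \<Rightarrow>
      indicator {a..b} t *\<^sub>R (complex_of_real \<bar>Z t w\<bar> * iexp (u * Y t w)))) \<partial>(lborel \<Otimes>\<^sub>M M)) < \<infinity>" .
qed measurable

lemma indicator_expectation_path_derivative:
  "indicator {a..b} t *\<^sub>R (\<integral>w. iexp (u * Y t w) * of_real \<bar>Z t w\<bar> \<partial>M) =
    (\<integral>w. indicator {a..b} t *\<^sub>R (of_real \<bar>Z t w\<bar> * iexp (u * Y t w)) \<partial>M)"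
  by (simp add: mult.commute)

lemma set_integrable_expectation_path_derivative:
  "set_integrable lborel {a..b} (\<lambda>t. \<integral>w. iexp (u * Y t w) * of_real \<bar>Z t w\<bar> \<partial>M)"
  unfolding set_integrable_def indicator_expectation_path_derivative
  using L.integrable_fst[OF integrable_path_derivative] .

text \<open>The exchanges are those of the finiteness proof, now with the phase
  \<open>iexp (u * y)\<close>, whose modulus is 1; that finiteness supplies the integrability Fubini
  requires.\<close>

lemma fourier_mean_crossings_eq:
  "fourier_mean_crossings M Y a b u =
    (LINT t:{a..b}|lborel. \<integral>w. iexp (u * Y t w) * of_real \<bar>Z t w\<bar> \<partial>M)"
proof -
  let ?N = "crossings Y a b"
  let ?J = "\<lambda>y w. of_real (enn2real (?N y w)) * iexp (u * y)"
  have J: "integrable (lborel \<Otimes>\<^sub>M M) (\<lambda>(y, w). ?J y w)"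
  proof (rule integrableI_bounded)
    have "(\<integral>\<^sup>+x. ennreal (norm (case x of (y, w) \<Rightarrow> ?J y w)) \<partial>(lborel \<Otimes>\<^sub>M M)) \<le>
        (\<integral>\<^sup>+x. (case x of (y, w) \<Rightarrow> ?N y w) \<partial>(lborel \<Otimes>\<^sub>M M))"
      by (intro nn_integral_mono) (auto simp: norm_mult ennreal_enn2real_if)
    then show "(\<integral>\<^sup>+x. ennreal (norm (case x of (y, w) \<Rightarrow> ?J y w)) \<partial>(lborel \<Otimes>\<^sub>M M)) < \<infinity>"
      using nn_integral_crossings_finite by (rule le_less_trans)
  qed measurable
  have fin: "AE y in lborel. mean_crossings M Y a b y \<noteq> \<infinity>"
    using nn_integral_mean_crossings_finite borel_measurable_mean_crossings
    by (intro nn_integral_noteq_infinite) auto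
  have "fourier_mean_crossings M Y a b u = (\<integral>y. (\<integral>w. ?J y w \<partial>M) \<partial>lborel)"
    unfolding fourier_mean_crossings_def fourier_transform_def
  proof (rule integral_cong_AE)
    show "(\<lambda>y. iexp (u * y) * complex_of_real (enn2real (mean_crossings M Y a b y))) \<in> borel_measurable lborel"
      using borel_measurable_mean_crossings by measurable
    show "(\<lambda>y. \<integral>w. ?J y w \<partial>M) \<in> borel_measurable lborel" by measurable
    show "AE y in lborel. iexp (u * y) * complex_of_real (enn2real (mean_crossings M Y a b y)) = (\<integral>w. ?J y w \<partial>M)"
      using fin
    proof eventually_elim
      case (elim y)
      \<comment> \<open>A finite mean forces finitely many crossings almost surely, and only then
        does \<open>enn2real\<close> pass through the expectation.\<close>
      have "AE w in M. ?N y w \<noteq> \<infinity>"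
        using elim by (intro nn_integral_noteq_infinite) (auto simp: mean_crossings_def)
      then have "(\<integral>\<^sup>+w. ennreal (enn2real (?N y w)) \<partial>M) = mean_crossings M Y a b y"
        unfolding mean_crossings_def by (intro nn_integral_cong_AE) (auto simp: less_top)
      then have "enn2real (mean_crossings M Y a b y) = (\<integral>w. enn2real (?N y w) \<partial>M)"
        by (subst integral_eq_nn_integral) auto
      then have "iexp (u * y) * complex_of_real (enn2real (mean_crossings M Y a b y)) =
          (\<integral>w. of_real (enn2real (?N y w)) \<partial>M) * iexp (u * y)"
        by (simp only: integral_complex_of_real mult.commute)
      also have "\<dots> = (\<integral>w. ?J y w \<partial>M)" by (simp only: integral_mult_left_zero)
      finally show ?case .
    qed
  qed
  also have "\<dots> = (\<integral>w. (\<integral>y. ?J y w \<partial>lborel) \<partial>M)" by (rule L.Fubini_integral[OF J, symmetric])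
  also have "\<dots> = (\<integral>w. (\<integral>t. indicator {a..b} t *\<^sub>R (of_real \<bar>Z t w\<bar> * iexp (u * Y t w)) \<partial>lborel) \<partial>M)"
  proof (rule Bochner_Integration.integral_cong[OF refl])
    fix w assume w: "w \<in> space M"
    have "(LINT y|lborel. ?J y w) = (LINT t:{a..b}|lborel. of_real \<bar>Z t w\<bar> * iexp (u * Y t w))"
      unfolding crossings_def
    proof (rule integral_level_count[OF ab der[OF w], where B = 1])
      show "continuous_on {a..b} (\<lambda>t. Z t w)" using Z_cont[OF w] by (rule continuous_on_subset) simp
      show "continuous_on UNIV (\<lambda>y. iexp (u * y))" by (intro continuous_intros)
    qed auto
    then show "(\<integral>y. ?J y w \<partial>lborel) =
        (\<integral>t. indicator {a..b} t *\<^sub>R (of_real \<bar>Z t w\<bar> * iexp (u * Y t w)) \<partial>lborel)"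
      by (simp add: set_lebesgue_integral_def)
  qed
  also have "\<dots> = (\<integral>t. (\<integral>w. indicator {a..b} t *\<^sub>R (of_real \<bar>Z t w\<bar> * iexp (u * Y t w)) \<partial>M) \<partial>lborel)"
    by (rule L.Fubini_integral[OF integrable_path_derivative])
  also have "\<dots> = (LINT t:{a..b}|lborel. \<integral>w. iexp (u * Y t w) * of_real \<bar>Z t w\<bar> \<partial>M)"
    unfolding set_lebesgue_integral_def indicator_expectation_path_derivative ..
  finally show ?thesis .
qed

end

end

text \<open>
  The paths are set to \<open>0\<close> on a measurable null set containing all bad outcomes, and are extended
  beyond \<open>{a..b}\<close> by their endpoint values.
\<close>

lemma C1_modification:
  fixes X :: "real \<Rightarrow> 'w \<Rightarrow> real"
  assumes "a < b" and meas: "\<And>t. t \<in> {a..b} \<Longrightarrow> X t \<in> borel_measurable M"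
    and C1: "almost_surely_C1 M a b X"
  obtains Y Z where "\<And>t. Y t \<in> borel_measurable M" "\<And>t. Z t \<in> borel_measurable M"
    "\<And>w. continuous_on UNIV (\<lambda>t. Y t w)" "\<And>w. continuous_on UNIV (\<lambda>t. Z t w)"
    "\<And>t w. t \<in> {a..b} \<Longrightarrow> ((\<lambda>s. Y s w) has_real_derivative Z t w) (at t within {a..b})"
    "AE w in M. \<forall>t\<in>{a..b}. X t w = Y t w"
proof -
  define good where "good w D \<longleftrightarrow>
    (\<forall>t\<in>{a..b}. ((\<lambda>s. X s w) has_real_derivative D t) (at t within {a..b})) \<and> continuous_on {a..b} D" for w D
  obtain N where N: "{w \<in> space M. \<not> (\<exists>D. good w D)} \<subseteq> N" "N \<in> null_sets M"
    using C1 unfolding almost_surely_C1_def good_def by (elim AE_E) (auto simp: null_sets_def)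
  define D where "D w = (SOME D. good w D)" for w
  have D: "good w (D w)" if "w \<in> space M - N" for w
  proof -
    have "\<exists>D. good w D" using N(1) that by blast
    then show ?thesis unfolding D_def by (rule someI_ex)
  qed
  define c where "c t = max a (min b t)" for t
  have c: "c t \<in> {a..b}" for t using \<open>a < b\<close> by (auto simp: c_def)
  have c_id: "c t = t" if "t \<in> {a..b}" for t using that by (auto simp: c_def)
  have c_cont: "continuous_on UNIV c" unfolding c_def by (intro continuous_intros)
  define Y where "Y t w = (if w \<in> space M - N then X (c t) w else 0)" for t w
  define Z where "Z t w = (if w \<in> space M - N then D w (c t) else 0)" for t w
  have N_sets[measurable]: "N \<in> sets M" using N(2) by auto
  have Y: "Y t \<in> borel_measurable M" for t
    unfolding Y_def[abs_def] using meas[OF c[of t]] by measurable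
  have der: "((\<lambda>s. Y s w) has_real_derivative Z t w) (at t within {a..b})" if t: "t \<in> {a..b}" for t w
  proof (cases "w \<in> space M - N")
    case True
    have "((\<lambda>s. X s w) has_real_derivative Z t w) (at t within {a..b})"
      using D[OF True] t c_id[OF t] True by (simp add: good_def Z_def)
    then show ?thesis
      by (rule has_field_derivative_transform_within[of _ _ _ _ 1]) (use t True c_id in \<open>auto simp: Y_def\<close>)
  next
    case False
    then have "(\<lambda>s. Y s w) = (\<lambda>_. 0)" "Z t w = 0" by (auto simp: Y_def Z_def)
    then show ?thesis by simp
  qed
  \<comment> \<open>\<open>D w\<close> is picked separately for each outcome, so nothing in its
    choice is measurable; \<open>Z t\<close> is measurable as the pathwise derivative of
    \<open>Y\<close>.\<close>
  have Z: "Z t \<in> borel_measurable M" for t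
  proof -
    have "Z (c t) \<in> borel_measurable M"
      by (rule borel_measurable_path_derivative[OF \<open>a < b\<close> c Y der[OF c]])
    moreover have "Z (c t) = Z t" using c_id[OF c[of t]] by (simp add: Z_def fun_eq_iff)
    ultimately show ?thesis by simp
  qed
  have "continuous_on UNIV (\<lambda>t. Y t w)" for w
  proof (cases "w \<in> space M - N")
    case True
    have "continuous_on {a..b} (\<lambda>t. X t w)"
      using D[OF True] unfolding good_def by (meson DERIV_continuous continuous_on_eq_continuous_within)
    then have "continuous_on UNIV (\<lambda>t. X (c t) w)"
      by (rule continuous_on_compose2[OF _ c_cont]) (use c in auto)
    then show ?thesis using True by (simp add: Y_def)
  next
    case False
    then have "Y t w = 0" for t by (auto simp: Y_def)
    then show ?thesis by (simp only: continuous_on_const)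
  qed
  moreover have "continuous_on UNIV (\<lambda>t. Z t w)" for w
  proof (cases "w \<in> space M - N")
    case True
    have "continuous_on {a..b} (D w)" using D[OF True] unfolding good_def by blast
    then have "continuous_on UNIV (\<lambda>t. D w (c t))"
      by (rule continuous_on_compose2[OF _ c_cont]) (use c in auto)
    then show ?thesis using True by (simp add: Z_def)
  next
    case False
    then have "Z t w = 0" for t by (auto simp: Z_def)
    then show ?thesis by (simp only: continuous_on_const)
  qed
  moreover have "AE w in M. \<forall>t\<in>{a..b}. X t w = Y t w"
    using AE_not_in[OF N(2)] AE_space by eventually_elim (auto simp: Y_def c_id)
  ultimately show thesis using that[of Y Z] Y Z der by blast
qed

section \<open>Transfer to the original process\<close>

theorem theorem1:
  fixes M :: "'w measure" and X X' :: "real \<Rightarrow> 'w \<Rightarrow> real" and a b :: real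
  assumes "prob_space M"
    and "a < b"
    and "second_order_process M a b X"
    and "almost_surely_C1 M a b X"
    and "mean_square_C1 M a b X"
    and "derivative_process M a b X X'"
  defines "F \<equiv> fourier_mean_crossings M X a b"
    and "G \<equiv> (\<lambda>u t. \<integral>w. exp (\<i> * of_real (u * X t w)) * of_real \<bar>X' t w\<bar> \<partial>M)"
    and "\<psi> \<equiv> (\<lambda>t. joint_char M (X t) (X' t))"
    and "d\<psi> \<equiv> (\<lambda>t. joint_char_dv M (X t) (X' t))"
  defines "I1 \<equiv> (\<lambda>u t v. of_real (1 / v) * (d\<psi> t u v - d\<psi> t u (- v)))"
    and "I2 \<equiv> (\<lambda>u t v. of_real (1 / v\<^sup>2) * (\<psi> t u v + \<psi> t u (- v) - 2 * \<psi> t u 0))"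
  shows "mean_crossings M X a b \<in> borel_measurable lborel \<and>
    (\<integral>\<^sup>+\<alpha>. mean_crossings M X a b \<alpha> \<partial>lborel) < \<infinity> \<and>
    (\<forall>u::real.
      (\<forall>t\<in>{a..b}. integrable M (\<lambda>w. exp (\<i> * of_real (u * X t w)) * complex_of_real \<bar>X' t w\<bar>)) \<and>
      set_integrable lborel {a..b} (G u) \<and>
      F u = (LINT t:{a..b}|lborel. G u t)) \<and>
    (\<forall>u::real.
      (\<forall>t\<in>{a..b}. \<forall>v. \<psi> t u differentiable (at v)) \<and>
      (\<forall>t\<in>{a..b}. improper_integrable (I1 u t)) \<and>
      set_integrable lborel {a..b} (\<lambda>t. improper_integral (I1 u t)) \<and>
      F u = - of_real (1 / pi) * (LINT t:{a..b}|lborel. improper_integral (I1 u t)) \<and>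
      (\<forall>t\<in>{a..b}. improper_integrable (I2 u t)) \<and>
      set_integrable lborel {a..b} (\<lambda>t. improper_integral (I2 u t)) \<and>
      F u = - of_real (1 / pi) * (LINT t:{a..b}|lborel. improper_integral (I2 u t)))"
proof -
  interpret prob_space M by fact
  have X_sq: "square_integrable M (X t)" if "t \<in> {a..b}" for t
    using assms(3) that by (simp add: second_order_process_def)
  then have X_meas: "X t \<in> borel_measurable M" if "t \<in> {a..b}" for t
    using that by (simp add: square_integrable_def)
  have X'_meas: "X' t \<in> borel_measurable M"
    and X'_der: "AE w in M. ((\<lambda>s. X s w) has_real_derivative X' t w) (at t within {a..b})"
    if "t \<in> {a..b}" for t
    using assms(6) that by (auto simp: derivative_process_def)
  obtain D where D_sq: "\<And>t. t \<in> {a..b} \<Longrightarrow> square_integrable M (D t)"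
    and D_lim: "\<And>t. t \<in> {a..b} \<Longrightarrow>
      ((\<lambda>s. \<integral>w. ((X s w - X t w) / (s - t) - D t w)\<^sup>2 \<partial>M) \<longlongrightarrow> 0) (at t within {a..b})"
    and D_cont: "\<And>t. t \<in> {a..b} \<Longrightarrow> ((\<lambda>s. \<integral>w. (D s w - D t w)\<^sup>2 \<partial>M) \<longlongrightarrow> 0) (at t within {a..b})"
    using assms(5) unfolding mean_square_C1_def by blast
  obtain K where K: "\<And>t. t \<in> {a..b} \<Longrightarrow> (\<integral>w. (D t w)\<^sup>2 \<partial>M) \<le> K"
    using mean_square_continuous_bounded[OF D_sq D_cont] by blast
  obtain Y Z where Y: "\<And>t. Y t \<in> borel_measurable M" and Z: "\<And>t. Z t \<in> borel_measurable M"
    and Y_cont: "\<And>w. continuous_on UNIV (\<lambda>t. Y t w)" and Z_cont: "\<And>w. continuous_on UNIV (\<lambda>t. Z t w)"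
    and der: "\<And>t w. t \<in> {a..b} \<Longrightarrow> ((\<lambda>s. Y s w) has_real_derivative Z t w) (at t within {a..b})"
    and XY: "AE w in M. \<forall>t\<in>{a..b}. X t w = Y t w"
  proof (rule C1_modification[OF assms(2) _ assms(4)])
    show "X t \<in> borel_measurable M" if "t \<in> {a..b}" for t using X_meas[OF that] .
  qed (rule that)
  \<comment> \<open>Three derivatives are in play: the given version \<open>X'\<close>, the mean
    square derivative \<open>D\<close>, which carries the second moments, and \<open>Z\<close>,
    which carries the path regularity. At each time they agree almost surely.\<close>
  have X'_D: "AE w in M. X' t w = D t w" if "t \<in> {a..b}" for t
    by (rule AE_eq_mean_square_derivative[OF assms(2) that X_sq D_sq[OF that] D_lim[OF that]
          X'_meas[OF that] X'_der[OF that]])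
  have X'_Z: "AE w in M. X' t w = Z t w" if t: "t \<in> {a..b}" for t
    using X'_der[OF t] XY
  proof eventually_elim
    case (elim w)
    have "((\<lambda>s. X s w) has_real_derivative Z t w) (at t within {a..b})"
      by (rule has_field_derivative_transform_within[OF der[OF t, of w], of 1]) (use t elim in auto)
    moreover have "at t within {a..b} \<noteq> bot" using t assms(2) by (simp add: trivial_limit_within)
    ultimately show ?case
      using elim(1) unfolding has_field_derivative_iff by (metis tendsto_unique)
  qed
  have X'_sq: "square_integrable M (X' t)" if t: "t \<in> {a..b}" for t
  proof -
    have [measurable]: "X' t \<in> borel_measurable M" "D t \<in> borel_measurable M"
      using X'_meas[OF t] D_sq[OF t] by (auto simp: square_integrable_def)
    have "integrable M (\<lambda>w. (X' t w)\<^sup>2)"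
      by (subst integrable_cong_AE[where g = "\<lambda>w. (D t w)\<^sup>2"])
        (use X'_D[OF t] D_sq[OF t] in \<open>auto simp: square_integrable_def\<close>)
    then show ?thesis by (simp add: square_integrable_def)
  qed
  have Z_le: "(\<integral>\<^sup>+w. ennreal \<bar>Z t w\<bar> \<partial>M) \<le> ennreal (1 + K)" if t: "t \<in> {a..b}" for t
  proof -
    have D_int: "integrable M (\<lambda>w. (D t w)\<^sup>2)" using D_sq[OF t] by (simp add: square_integrable_def)
    have "(\<integral>\<^sup>+w. ennreal \<bar>Z t w\<bar> \<partial>M) \<le> (\<integral>\<^sup>+w. ennreal (1 + (D t w)\<^sup>2) \<partial>M)"
    proof (rule nn_integral_mono_AE)
      show "AE w in M. ennreal \<bar>Z t w\<bar> \<le> ennreal (1 + (D t w)\<^sup>2)"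
        using X'_D[OF t] X'_Z[OF t]
      proof eventually_elim
        case (elim w)
        have "\<bar>z\<bar> \<le> 1 + z\<^sup>2" for z :: real
          using zero_le_power2[of "\<bar>z\<bar> - 1"] by (simp add: power2_diff)
        then show ?case using elim by (intro ennreal_leI) simp
      qed
    qed
    also have "\<dots> = ennreal (\<integral>w. 1 + (D t w)\<^sup>2 \<partial>M)"
      using D_int by (intro nn_integral_eq_integral) auto
    also have "(\<integral>w. 1 + (D t w)\<^sup>2 \<partial>M) = 1 + (\<integral>w. (D t w)\<^sup>2 \<partial>M)"
      using D_int by (simp add: prob_space)
    also have "ennreal \<dots> \<le> ennreal (1 + K)" using K[OF t] by (intro ennreal_leI) simp
    finally show ?thesis .
  qed
  note Y_facts = assms(2) Y Z Y_cont Z_cont der Z_le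
  \<comment> \<open>One null set must serve all times at once, since a level set involves
    uncountably many of them; \<open>XY\<close> is quantified accordingly.\<close>
  have mc: "mean_crossings M X a b = mean_crossings M Y a b"
  proof
    fix y
    show "mean_crossings M X a b y = mean_crossings M Y a b y"
      unfolding mean_crossings_def crossings_def
    proof (rule nn_integral_cong_AE)
      show "AE w in M. emeasure (count_space UNIV) {t \<in> {a..b}. X t w = y} =
          emeasure (count_space UNIV) {t \<in> {a..b}. Y t w = y}"
        using XY by eventually_elim (metis (mono_tags, lifting) Collect_cong)
    qed
  qed
  have F: "F = fourier_mean_crossings M Y a b"
    unfolding F_def fourier_mean_crossings_def mc ..
  have G: "G u t = (\<integral>w. iexp (u * Y t w) * of_real \<bar>Z t w\<bar> \<partial>M)" if t: "t \<in> {a..b}" for u t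
    unfolding G_def
  proof (rule integral_cong_AE)
    show "AE w in M. iexp (u * X t w) * of_real \<bar>X' t w\<bar> = iexp (u * Y t w) * complex_of_real \<bar>Z t w\<bar>"
      using XY X'_Z[OF t] by eventually_elim (use t in simp)
  qed (use X_meas[OF t] X'_meas[OF t] Y Z in measurable)
  have G_int: "set_integrable lborel {a..b} (G u)" for u
    using set_integrable_expectation_path_derivative[OF Y_facts, of u]
    by (subst set_integrable_cong[OF refl refl G]) auto
  have F_G: "F u = (LINT t:{a..b}|lborel. G u t)" for u
  proof -
    have "F u = (LINT t:{a..b}|lborel. \<integral>w. iexp (u * Y t w) * of_real \<bar>Z t w\<bar> \<partial>M)"
      unfolding F by (rule fourier_mean_crossings_eq[OF Y_facts])
    also have "\<dots> = (LINT t:{a..b}|lborel. G u t)"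
      by (intro set_lebesgue_integral_cong) (use G[of _ u] in auto)
    finally show ?thesis .
  qed
  have X'_int: "integrable M (\<lambda>w. iexp (u * X t w) * complex_of_real \<bar>X' t w\<bar>)" if "t \<in> {a..b}" for u t
    using X_meas[OF that] integrable_of_square_integrable[OF X'_sq[OF that]]
    by (intro integrable_iexp_mult) auto
  have \<psi>_diff: "\<psi> t u differentiable (at v)" if "t \<in> {a..b}" for t u v
    unfolding \<psi>_def using joint_char_has_vector_derivative[OF X_meas[OF that] X'_sq[OF that], of u v]
    by (rule differentiableI_vector)
  have I1: "improper_integrable (I1 u t)" "improper_integral (I1 u t) = - of_real pi * G u t"
    if "t \<in> {a..b}" for u t
    using improper_integrable_joint_char_dv[OF X_meas[OF that] X'_sq[OF that], of u]
      improper_integral_joint_char_dv[OF X_meas[OF that] X'_sq[OF that], of u]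
    unfolding I1_def d\<psi>_def G_def by auto
  have I2: "improper_integrable (I2 u t)" "improper_integral (I2 u t) = - of_real pi * G u t"
    if "t \<in> {a..b}" for u t
    using improper_integrable_joint_char[OF X_meas[OF that] X'_sq[OF that], of u]
      improper_integral_joint_char[OF X_meas[OF that] X'_sq[OF that], of u]
    unfolding I2_def \<psi>_def G_def by auto
  \<comment> \<open>Both inner integrals equal \<open>- pi * G u t\<close> for every
    \<open>t\<close> in [a,b], so one computation settles both formulas.\<close>
  have rescale: "set_integrable lborel {a..b} J \<and> F u = - of_real (1 / pi) * (LINT t:{a..b}|lborel. J t)"
    if J: "\<And>t. t \<in> {a..b} \<Longrightarrow> J t = - of_real pi * G u t" for J u
  proof
    have "set_integrable lborel {a..b} (\<lambda>t. - of_real pi * G u t)"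
      by (intro set_integrable_mult_right G_int)
    then show "set_integrable lborel {a..b} J"
      using J by (subst set_integrable_cong[where f' = "\<lambda>t. - of_real pi * G u t"]) simp_all
    have "(LINT t:{a..b}|lborel. J t) = (LINT t:{a..b}|lborel. - of_real pi * G u t)"
      by (intro set_lebesgue_integral_cong) (auto simp: J)
    also have "\<dots> = - of_real pi * F u" unfolding F_G by (rule set_integral_mult_right)
    finally show "F u = - of_real (1 / pi) * (LINT t:{a..b}|lborel. J t)" by simp
  qed
  have "mean_crossings M X a b \<in> borel_measurable lborel"
    unfolding mc using borel_measurable_mean_crossings[OF Y_facts] by simp
  moreover have "(\<integral>\<^sup>+\<alpha>. mean_crossings M X a b \<alpha> \<partial>lborel) < \<infinity>"
    unfolding mc by (rule nn_integral_mean_crossings_finite[OF Y_facts])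
  ultimately show ?thesis
    using G_int F_G X'_int \<psi>_diff I1(1) I2(1) rescale[OF I1(2)] rescale[OF I2(2)] by blast
qed

end
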